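(* Let $p(a,x)\in\mathbb R\langle a,x\rangle$ be a symmetric polynomial. If $p$ is (globally) convex in $a$ and (globally) convex in $x$ separately, then there exist an $m$ and polynomials $L(a,x)$ and $\Lambda_j(a,x)$, $j=1,\dots,m$, each of which has degree at most one in $x$ and degree at most one in $a$ (thus degree at most two jointly), such that $$p(a,x)=L(a,x)+\Lambda(a,x)^T\Lambda(a,x)=L(a,x)+\sum_{j=1}^m\Lambda_j(a,x)^T\Lambda_j(a,x),$$ where $\Lambda(a,x)$ is the column vector with entries $\Lambda_j(a,x)$.
   Context: Fix a positive integer $g$. $\mathbb R\langle a,x\rangle$ denotes the polynomials with real coefficients in the non-commuting variables $a=(a_1,\dots,a_g)$, $x=(x_1,\dots,x_g)$. The involution ${}^T$ on $\mathbb R\langle a,x\rangle$ is linear, reverses the order of words, and fixes each variable; $p$ is symmetric if $p^T=p$. $\mathbb S_n(\mathbb R^g)$ is the set of $g$-tuples of real symmetric $n\times n$ matrices, and polynomials are evaluated at $(A,X)$ with $A,X\in\mathbb S_n(\mathbb R^g)$ by substitution. $P\succeq Q$ means $P-Q$ is symmetric positive semidefinite. $p$ is convex in $x$ if $tp(A,X)+(1-t)p(A,Y)\succeq p(A,tX+(1-t)Y)$ for all $n$, all $A,X,Y\in\mathbb S_n(\mathbb R^g)$ and all $0<t<1$. $p$ is convex in $a$ if $tp(A,X)+(1-t)p(B,X)\succeq p(tA+(1-t)B,X)$ for all $n$, all $A,B,X\in\mathbb S_n(\mathbb R^g)$ and all $0<t<1$. *)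

theory Defs
  imports "HOL-Library.Poly_Mapping" "Jordan_Normal_Form.Matrix"
begin

section \<open>Non-commutative polynomials\<close>

text \<open>Words form the free monoid under concatenation. It is written additively, because
  multiplication of poly_mappings is convolution over an (in general non-commutative) additive
  monoid of exponents. Hence \<open>'v word \<Rightarrow>\<^sub>0 real\<close>, with the library's ring operations, is the free
  real algebra on \<open>'v\<close>.\<close>

datatype 'v word = Word (letters: "'v list")

instantiation word :: (type) monoid_add
begin

definition zero_word :: "'a word" where
  "0 = Word []"

definition plus_word :: "'a word \<Rightarrow> 'a word \<Rightarrow> 'a word" where
  "u + v = Word (letters u @ letters v)"

instance
  by standard (simp_all add: zero_word_def plus_word_def)

end

text \<open>The index type \<open>'g\<close> stands for the set of indices 1, ..., g: the variables are
  \<open>VarA i\<close> for \<open>a\<^sub>i\<close> and \<open>VarX i\<close> for \<open>x\<^sub>i\<close>.\<close>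

datatype 'g ncvar = VarA 'g | VarX 'g

type_synonym 'g ncpoly = "'g ncvar word \<Rightarrow>\<^sub>0 real"

definition rev_word :: "'v word \<Rightarrow> 'v word" where
  "rev_word w = Word (rev (letters w))"

definition involution :: "'g ncpoly \<Rightarrow> 'g ncpoly" where
  "involution p = (\<Sum>w\<in>Poly_Mapping.keys p. Poly_Mapping.single (rev_word w) (Poly_Mapping.lookup p w))"

definition symmetric_ncpoly :: "'g ncpoly \<Rightarrow> bool" where
  "symmetric_ncpoly p \<longleftrightarrow> involution p = p"

text \<open>Degree in the variables belonging to \<open>V\<close>; the zero polynomial gets degree 0.\<close>

definition degree_in :: "'g ncvar set \<Rightarrow> 'g ncpoly \<Rightarrow> nat" where
  "degree_in V p = Max (insert 0 ((\<lambda>w. length (filter (\<lambda>v. v \<in> V) (letters w))) ` Poly_Mapping.keys p))"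

definition degree_a :: "'g ncpoly \<Rightarrow> nat" where
  "degree_a = degree_in (range VarA)"

definition degree_x :: "'g ncpoly \<Rightarrow> nat" where
  "degree_x = degree_in (range VarX)"


section \<open>Evaluation at tuples of symmetric matrices\<close>

definition sym_tuples :: "nat \<Rightarrow> ('g \<Rightarrow> real mat) set" where
  "sym_tuples n = {A. \<forall>i. A i \<in> carrier_mat n n \<and> transpose_mat (A i) = A i}"

fun subst_var :: "('g \<Rightarrow> real mat) \<Rightarrow> ('g \<Rightarrow> real mat) \<Rightarrow> 'g ncvar \<Rightarrow> real mat" where
  "subst_var A X (VarA i) = A i"
| "subst_var A X (VarX i) = X i"

definition word_eval ::
  "nat \<Rightarrow> ('g \<Rightarrow> real mat) \<Rightarrow> ('g \<Rightarrow> real mat) \<Rightarrow> 'g ncvar word \<Rightarrow> real mat" where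
  "word_eval n A X w = foldr (\<lambda>v M. subst_var A X v * M) (letters w) (1\<^sub>m n)"

text \<open>The linear combination of the word values is written entrywise, since the matrix type
  mixes all sizes and so is not a \<open>comm_monoid_add\<close>.\<close>

definition ncpoly_eval ::
  "nat \<Rightarrow> 'g ncpoly \<Rightarrow> ('g \<Rightarrow> real mat) \<Rightarrow> ('g \<Rightarrow> real mat) \<Rightarrow> real mat" where
  "ncpoly_eval n p A X =
     mat n n (\<lambda>ij. \<Sum>w\<in>Poly_Mapping.keys p. Poly_Mapping.lookup p w * (word_eval n A X w $$ ij))"


section \<open>Partial convexity\<close>

definition psd :: "nat \<Rightarrow> real mat \<Rightarrow> bool" where
  "psd n M \<longleftrightarrow> M \<in> carrier_mat n n \<and> transpose_mat M = M \<and>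
     (\<forall>v\<in>carrier_vec n. 0 \<le> v \<bullet> (M *\<^sub>v v))"

definition loewner_ge :: "nat \<Rightarrow> real mat \<Rightarrow> real mat \<Rightarrow> bool" where
  "loewner_ge n P Q \<longleftrightarrow> psd n (P - Q)"

definition convex_comb ::
  "real \<Rightarrow> ('g \<Rightarrow> real mat) \<Rightarrow> ('g \<Rightarrow> real mat) \<Rightarrow> 'g \<Rightarrow> real mat" where
  "convex_comb t A B = (\<lambda>i. t \<cdot>\<^sub>m A i + (1 - t) \<cdot>\<^sub>m B i)"

definition convex_in_x :: "'g ncpoly \<Rightarrow> bool" where
  "convex_in_x p \<longleftrightarrow>
     (\<forall>n. \<forall>A\<in>sym_tuples n. \<forall>X\<in>sym_tuples n. \<forall>Y\<in>sym_tuples n. \<forall>t. 0 < t \<and> t < 1 \<longrightarrow>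
        loewner_ge n (t \<cdot>\<^sub>m ncpoly_eval n p A X + (1 - t) \<cdot>\<^sub>m ncpoly_eval n p A Y)
                     (ncpoly_eval n p A (convex_comb t X Y)))"

definition convex_in_a :: "'g ncpoly \<Rightarrow> bool" where
  "convex_in_a p \<longleftrightarrow>
     (\<forall>n. \<forall>A\<in>sym_tuples n. \<forall>B\<in>sym_tuples n. \<forall>X\<in>sym_tuples n. \<forall>t. 0 < t \<and> t < 1 \<longrightarrow>
        loewner_ge n (t \<cdot>\<^sub>m ncpoly_eval n p A X + (1 - t) \<cdot>\<^sub>m ncpoly_eval n p B X)
                     (ncpoly_eval n p (convex_comb t A B) X))"

end

theory Submission
  imports Defs "HOL-Analysis.Analysis"
begin

text \<open>Call a word \<open>u\<close> a border if it is \<open>x\<^sub>j\<close>, \<open>a\<^sub>k x\<^sub>j\<close> or \<open>x\<^sub>j a\<^sub>k\<close> (a border for \<open>x\<close>), or the same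
with the roles of \<open>a\<close> and \<open>x\<close> exchanged (a border for \<open>a\<close>). The theorem is a statement about Gram
matrices: if \<open>H\<close> is a positive semidefinite matrix indexed by all borders, then factoring \<open>H\<close>
turns \<open>\<Sum> H u v u\<^sup>T v\<close> into a sum of squares of linear combinations of borders, and borders have degree
at most one in \<open>a\<close> and in \<open>x\<close>. Hence it suffices to choose \<open>H\<close> such that every word of degree at
least two in \<open>a\<close> or in \<open>x\<close> receives its coefficient in \<open>p\<close>; what is left over is \<open>L\<close>.

Which words occur. Convexity in \<open>x\<close> is used only through midpoint convexity of the quadratic
form of \<open>p\<close>, evaluated at symmetric kernels on finite sets, that is, at weighted graphs whose edges
are labelled by letters; the entries of a word are then sums over walks spelling it. For a word
\<open>w = u x m y z\<close> with \<open>x\<close>, \<open>y\<close> among the convex letters take the path spelling \<open>w\<close>, and the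
same path with both marked edges negated; in the midpoint the marked edges disappear. If no word of
\<open>p\<close> is rich enough to walk from the start across the first marked edge and back, the corner entry of
the resulting positive semidefinite difference vanishes, so its row does, and the entry between the
ends of the path is the coefficient of \<open>w\<close> (\<open>coefficient_vanishes\<close>). This bounds both degrees by two
(\<open>midconvex_degree_le_2\<close>) and kills the words \<open>aaxx\<close> and \<open>xxaa\<close> (\<open>coeff_AAXX\<close>, \<open>coeff_XXAA\<close>), so that
every word of degree two in \<open>x\<close> is \<open>u\<^sup>T v\<close> for borders \<open>u\<close>, \<open>v\<close> for \<open>x\<close> (\<open>border_product\<close>).

One variable class. For the quadratic part in \<open>x\<close> a Gram matrix exists by duality
(\<open>gram_by_duality\<close>): otherwise a hyperplane separates the coefficients from the cone of Gram matrices,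
and it is a functional \<open>l\<close> on words with \<open>l w\<^sup>T = l w\<close> whose Hankel matrix \<open>l (u\<^sup>T v)\<close> is positive
definite while \<open>\<Sum> p\<^sub>w l w < 0\<close>. A construction in the style of Gelfand, Naimark and Segal realises \<open>l\<close> by
symmetric matrices and a vector state, where convexity shows that this sum is nonnegative
(\<open>gns_positivity\<close>).

Both classes. The Gram matrices for \<open>x\<close> and for \<open>a\<close> share the borders of length two. A word of
length four determines its two halves, so on these borders both matrices carry the coefficients of
\<open>p\<close> and agree. Two positive semidefinite matrices that agree on their overlap have a common positive
semidefinite completion (\<open>psd_completion\<close>). The entries between \<open>x\<^sub>i\<close> and \<open>a\<^sub>j\<close> created by it
only contribute words of degree one in \<open>a\<close> and in \<open>x\<close>, which \<open>L\<close> absorbs.\<close>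

hide_const (open) Finite_Cartesian_Product.vec Finite_Cartesian_Product.mat

section \<open>Words acting on vectors\<close>

text \<open>A family \<open>K\<close> of kernels on \<open>S\<close> is a tuple of matrices with index set \<open>S\<close>, one for each letter, and
\<open>act S K w f\<close> is the value of the word \<open>w\<close> at this tuple, applied to the vector \<open>f\<close>. Allowing an
arbitrary index set makes it possible to use vertices of a graph, or a direct sum, as the basis.\<close>
fun act :: "'b set \<Rightarrow> ('v \<Rightarrow> 'b \<Rightarrow> 'b \<Rightarrow> real) \<Rightarrow> 'v list \<Rightarrow> ('b \<Rightarrow> real) \<Rightarrow> 'b \<Rightarrow> real" where
  "act S K [] f s = f s"
| "act S K (v # w) f s = (\<Sum>t\<in>S. K v s t * act S K w f t)"

definition dot :: "'b set \<Rightarrow> ('b \<Rightarrow> real) \<Rightarrow> ('b \<Rightarrow> real) \<Rightarrow> real" where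
  "dot S f g = (\<Sum>s\<in>S. f s * g s)"

definition sym_kernels :: "'b set \<Rightarrow> ('v \<Rightarrow> 'b \<Rightarrow> 'b \<Rightarrow> real) \<Rightarrow> bool" where
  "sym_kernels S K \<longleftrightarrow> (\<forall>v. \<forall>s\<in>S. \<forall>t\<in>S. K v s t = K v t s)"

abbreviation support :: "('v list \<Rightarrow> real) \<Rightarrow> 'v list set" where
  "support c \<equiv> {w. c w \<noteq> 0}"

definition qform :: "'b set \<Rightarrow> ('v list \<Rightarrow> real) \<Rightarrow> ('v \<Rightarrow> 'b \<Rightarrow> 'b \<Rightarrow> real) \<Rightarrow> ('b \<Rightarrow> real) \<Rightarrow> real" where
  "qform S c K f = (\<Sum>w\<in>support c. c w * dot S f (act S K w f))"

definition midpoint_kernel ::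
  "('v \<Rightarrow> 'b \<Rightarrow> 'b \<Rightarrow> real) \<Rightarrow> ('v \<Rightarrow> 'b \<Rightarrow> 'b \<Rightarrow> real) \<Rightarrow> 'v \<Rightarrow> 'b \<Rightarrow> 'b \<Rightarrow> real" where
  "midpoint_kernel K K' v s t = (K v s t + K' v s t) / 2"

text \<open>The form in which partial convexity enters the proof. The convex letters are an arbitrary set \<open>V\<close>, so
that one argument serves both \<open>range VarX\<close> and \<open>range VarA\<close>.\<close>
definition midconvex_in :: "'v set \<Rightarrow> ('v list \<Rightarrow> real) \<Rightarrow> bool" where
  "midconvex_in V c \<longleftrightarrow>
     (\<forall>(n::nat) K K' f. sym_kernels {..<n} K \<and> sym_kernels {..<n} K' \<and> (\<forall>v. v \<notin> V \<longrightarrow> K v = K' v) \<longrightarrow>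
        qform {..<n} c (midpoint_kernel K K') f \<le> (qform {..<n} c K f + qform {..<n} c K' f) / 2)"

lemma act_append: "act S K (u @ w) f = act S K u (act S K w f)"
proof (induction u)
  case (Cons v u)
  then show ?case by (intro ext) simp
qed (simp add: fun_eq_iff)

lemma dot_sym: "dot S f g = dot S g f"
  by (simp add: dot_def mult.commute)

lemma dot_act_adjoint:
  assumes "sym_kernels S K"
  shows "dot S f (act S K w g) = dot S (act S K (rev w) f) g"
proof (induction w arbitrary: f)
  case Nil
  then show ?case by (simp add: dot_def)
next
  case (Cons v w)
  have "dot S f (act S K (v # w) g) = (\<Sum>s\<in>S. \<Sum>t\<in>S. f s * K v s t * act S K w g t)"
    by (simp add: dot_def sum_distrib_left mult.assoc)
  also have "\<dots> = (\<Sum>t\<in>S. \<Sum>s\<in>S. f s * K v s t * act S K w g t)"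
    by (rule sum.swap)
  also have "\<dots> = dot S (act S K [v] f) (act S K w g)"
    using assms
    by (auto simp: dot_def sum_distrib_left sum_distrib_right sym_kernels_def ac_simps intro!: sum.cong)
  also have "\<dots> = dot S (act S K (rev w) (act S K [v] f)) g" by (rule Cons)
  also have "act S K (rev w) (act S K [v] f) = act S K (rev (v # w)) f"
    by (simp add: act_append)
  finally show ?case .
qed

lemma act_reindex:
  assumes "bij_betw e T S" "t \<in> T"
  shows "act T (\<lambda>v s t. K v (e s) (e t)) w (\<lambda>t. f (e t)) t = act S K w f (e t)"
  using assms(2)
proof (induction w arbitrary: t)
  case (Cons v w)
  have "act S K (v # w) f (e t) = (\<Sum>t'\<in>T. K v (e t) (e t') * act S K w f (e t'))"
    using sum.reindex_bij_betw[OF assms(1), of "\<lambda>t'. K v (e t) t' * act S K w f t'"] by simp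
  then show ?case using Cons by simp
qed simp

lemma qform_reindex:
  assumes "bij_betw e T S"
  shows "qform T c (\<lambda>v s t. K v (e s) (e t)) (\<lambda>t. f (e t)) = qform S c K f"
proof -
  have "dot T (\<lambda>t. f (e t)) (act T (\<lambda>v s t. K v (e s) (e t)) w (\<lambda>t. f (e t))) = dot S f (act S K w f)" for w
    using sum.reindex_bij_betw[OF assms, of "\<lambda>t. f t * act S K w f t"]
    by (simp add: dot_def act_reindex[OF assms] cong: sum.cong)
  then show ?thesis by (simp add: qform_def)
qed

text \<open>The definition speaks of kernels on \<open>{..<n}\<close>; transport along an enumeration frees the index set.\<close>
lemma midconvex_inD:
  assumes "midconvex_in V c" "finite S" "sym_kernels S K" "sym_kernels S K'" "\<And>v. v \<notin> V \<Longrightarrow> K v = K' v"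
  shows "qform S c (midpoint_kernel K K') f \<le> (qform S c K f + qform S c K' f) / 2"
proof -
  obtain e where e: "bij_betw e {..<card S} S"
    using ex_bij_betw_nat_finite[OF assms(2)] by (auto simp: atLeast0LessThan)
  let ?n = "card S" and ?p = "\<lambda>K v s t. K v (e s) (e t)"
  have "sym_kernels {..<?n} (?p K)" "sym_kernels {..<?n} (?p K')"
    using assms(3,4) bij_betwE[OF e] by (auto simp: sym_kernels_def)
  moreover have "?p K v = ?p K' v" if "v \<notin> V" for v using assms(5)[OF that] by simp
  ultimately have "qform {..<?n} c (midpoint_kernel (?p K) (?p K')) (\<lambda>t. f (e t))
      \<le> (qform {..<?n} c (?p K) (\<lambda>t. f (e t)) + qform {..<?n} c (?p K') (\<lambda>t. f (e t))) / 2"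
    using assms(1)[unfolded midconvex_in_def, rule_format, of ?n "?p K" "?p K'"] by blast
  moreover have "midpoint_kernel (?p K) (?p K') = ?p (midpoint_kernel K K')"
    by (simp add: midpoint_kernel_def fun_eq_iff)
  ultimately show ?thesis
    by (simp only: qform_reindex[OF e])
qed

section \<open>Evaluation at symmetric matrices\<close>

definition coeffs_of :: "('v word \<Rightarrow>\<^sub>0 real) \<Rightarrow> 'v list \<Rightarrow> real" where
  "coeffs_of p w = Poly_Mapping.lookup p (Word w)"

lemma keys_eq_Word_support: "Poly_Mapping.keys p = Word ` support (coeffs_of p)"
proof -
  have "w \<in> Word ` support (coeffs_of p)" if "w \<in> Poly_Mapping.keys p" for w
    using that by (intro image_eqI[of _ _ "letters w"]) (auto simp: coeffs_of_def in_keys_iff)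
  then show ?thesis by (auto simp: coeffs_of_def in_keys_iff)
qed

lemma finite_support_coeffs [simp]: "finite (support (coeffs_of p))"
  using finite_keys[of p] unfolding keys_eq_Word_support
  by (rule finite_imageD) (simp add: inj_on_def)

lemma sum_keys_coeffs:
  "(\<Sum>w\<in>Poly_Mapping.keys p. Poly_Mapping.lookup p w * F (letters w)) = (\<Sum>w\<in>support (coeffs_of p). coeffs_of p w * F w)"
  unfolding keys_eq_Word_support
  by (subst sum.reindex) (auto simp: inj_on_def coeffs_of_def)

definition kernel_mat :: "nat \<Rightarrow> (nat \<Rightarrow> nat \<Rightarrow> real) \<Rightarrow> real mat" where
  "kernel_mat n k = Matrix.mat n n (\<lambda>(r, s). k r s)"

definition kernel_tuple :: "nat \<Rightarrow> ('v \<Rightarrow> nat \<Rightarrow> nat \<Rightarrow> real) \<Rightarrow> ('g \<Rightarrow> 'v) \<Rightarrow> 'g \<Rightarrow> real mat" where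
  "kernel_tuple n K var i = kernel_mat n (K (var i))"

lemma kernel_tuple_sym:
  "sym_kernels {..<n} K \<Longrightarrow> kernel_tuple n K var \<in> sym_tuples n"
  by (auto simp: sym_tuples_def kernel_tuple_def kernel_mat_def sym_kernels_def intro!: eq_matI)

lemma word_eval_kernel:
  fixes K :: "'g ncvar \<Rightarrow> nat \<Rightarrow> nat \<Rightarrow> real" and n :: nat
  defines "A \<equiv> kernel_tuple n K VarA" and "X \<equiv> kernel_tuple n K VarX"
  shows "word_eval n A X (Word w) \<in> carrier_mat n n"
    and "word_eval n A X (Word w) *\<^sub>v Matrix.vec n f = Matrix.vec n (act {..<n} K w f)"
proof -
  have *: "word_eval n A X (Word w) \<in> carrier_mat n n \<and>
      word_eval n A X (Word w) *\<^sub>v Matrix.vec n f = Matrix.vec n (act {..<n} K w f)"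
  proof (induction w)
    case Nil
    then show ?case by (auto simp: word_eval_def)
  next
    case (Cons v w)
    have v: "subst_var A X v = kernel_mat n (K v)"
      by (cases v) (simp_all add: A_def X_def kernel_tuple_def)
    have m: "kernel_mat n (K v) \<in> carrier_mat n n" by (simp add: kernel_mat_def)
    have e: "word_eval n A X (Word (v # w)) = kernel_mat n (K v) * word_eval n A X (Word w)"
      by (simp add: word_eval_def v)
    have "kernel_mat n (K v) *\<^sub>v Matrix.vec n (act {..<n} K w f) = Matrix.vec n (act {..<n} K (v # w) f)"
      by (rule eq_vecI) (auto simp: kernel_mat_def scalar_prod_def atLeast0LessThan)
    then show ?case using Cons m unfolding e
      by (auto simp: assoc_mult_mat_vec[OF m])
  qed
  show "word_eval n A X (Word w) \<in> carrier_mat n n"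
    and "word_eval n A X (Word w) *\<^sub>v Matrix.vec n f = Matrix.vec n (act {..<n} K w f)"
    using * by auto
qed

lemma quadratic_form_ncpoly_eval:
  fixes K :: "'g ncvar \<Rightarrow> nat \<Rightarrow> nat \<Rightarrow> real"
  shows "Matrix.vec n f \<bullet> (ncpoly_eval n p (kernel_tuple n K VarA) (kernel_tuple n K VarX) *\<^sub>v Matrix.vec n f)
    = qform {..<n} (coeffs_of p) K f"
proof -
  let ?E = "word_eval n (kernel_tuple n K VarA) (kernel_tuple n K VarX)"
  have c: "?E (Word w) \<in> carrier_mat n n" for w by (rule word_eval_kernel)
  have ent: "act {..<n} K w f i = (\<Sum>j<n. ?E (Word w) $$ (i, j) * f j)" if "i < n" for i w
  proof -
    have "act {..<n} K w f i = (?E (Word w) *\<^sub>v Matrix.vec n f) $ i"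
      using that by (simp add: word_eval_kernel(2))
    also have "\<dots> = (\<Sum>j<n. ?E (Word w) $$ (i, j) * f j)"
      using that c[of w] by (auto simp: scalar_prod_def atLeast0LessThan)
    finally show ?thesis .
  qed
  have "Matrix.vec n f \<bullet> (ncpoly_eval n p (kernel_tuple n K VarA) (kernel_tuple n K VarX) *\<^sub>v Matrix.vec n f)
    = (\<Sum>i<n. \<Sum>j<n. f i * f j * (\<Sum>w\<in>Poly_Mapping.keys p. Poly_Mapping.lookup p w * (?E (Word (letters w)) $$ (i, j))))"
    by (simp add: scalar_prod_def ncpoly_eval_def atLeast0LessThan sum_distrib_left ac_simps)
  also have "\<dots> = (\<Sum>i<n. \<Sum>j<n. f i * f j * (\<Sum>w\<in>support (coeffs_of p). coeffs_of p w * (?E (Word w) $$ (i, j))))"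
    using sum_keys_coeffs[of p "\<lambda>w. ?E (Word w) $$ _"] by simp
  also have "\<dots> = (\<Sum>i<n. \<Sum>j<n. \<Sum>w\<in>support (coeffs_of p). coeffs_of p w * (f i * (?E (Word w) $$ (i, j) * f j)))"
    by (simp add: sum_distrib_left ac_simps)
  also have "\<dots> = (\<Sum>w\<in>support (coeffs_of p). \<Sum>i<n. \<Sum>j<n. coeffs_of p w * (f i * (?E (Word w) $$ (i, j) * f j)))"
    by (subst sum.swap, subst (2) sum.swap) (rule refl)
  also have "\<dots> = qform {..<n} (coeffs_of p) K f"
    by (simp add: qform_def dot_def ent sum_distrib_left)
  finally show ?thesis .
qed

lemma loewner_ge_midpoint_qform:
  fixes K K' M :: "'g ncvar \<Rightarrow> nat \<Rightarrow> nat \<Rightarrow> real"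
  assumes "loewner_ge n ((1/2) \<cdot>\<^sub>m ncpoly_eval n p (kernel_tuple n K VarA) (kernel_tuple n K VarX)
      + (1 - 1/2) \<cdot>\<^sub>m ncpoly_eval n p (kernel_tuple n K' VarA) (kernel_tuple n K' VarX))
      (ncpoly_eval n p (kernel_tuple n M VarA) (kernel_tuple n M VarX))"
  shows "qform {..<n} (coeffs_of p) M f \<le> (qform {..<n} (coeffs_of p) K f + qform {..<n} (coeffs_of p) K' f) / 2"
proof -
  let ?P = "\<lambda>K. ncpoly_eval n p (kernel_tuple n K VarA) (kernel_tuple n K VarX)"
  let ?v = "Matrix.vec n f"
  have "?v \<bullet> (((1/2) \<cdot>\<^sub>m ?P K + (1 - 1/2) \<cdot>\<^sub>m ?P K' - ?P M) *\<^sub>v ?v)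
     = (1/2) * (?v \<bullet> (?P K *\<^sub>v ?v)) + (1/2) * (?v \<bullet> (?P K' *\<^sub>v ?v)) - ?v \<bullet> (?P M *\<^sub>v ?v)"
    unfolding ncpoly_eval_def
    by (simp add: scalar_prod_def atLeast0LessThan sum_distrib_left algebra_simps
        flip: sum.distrib sum_subtractf sum_divide_distrib)
      (simp add: add_divide_distrib sum.distrib sum_subtractf algebra_simps sum_distrib_left sum_divide_distrib)
  moreover have "0 \<le> ?v \<bullet> (((1/2) \<cdot>\<^sub>m ?P K + (1 - 1/2) \<cdot>\<^sub>m ?P K' - ?P M) *\<^sub>v ?v)"
    using assms by (auto simp: loewner_ge_def psd_def)
  ultimately show ?thesis by (simp add: quadratic_form_ncpoly_eval)
qed

lemma convex_comb_kernel_tuple: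
  "convex_comb (1/2) (kernel_tuple n K var) (kernel_tuple n K' var) = kernel_tuple n (midpoint_kernel K K') var"
  by (auto simp: convex_comb_def kernel_tuple_def kernel_mat_def midpoint_kernel_def fun_eq_iff
      add_divide_distrib intro!: eq_matI)

lemma convex_in_x_imp_midconvex:
  assumes "convex_in_x p"
  shows "midconvex_in (range VarX) (coeffs_of p)"
  unfolding midconvex_in_def
proof (intro allI impI, elim conjE)
  fix n :: nat and K K' :: "'a ncvar \<Rightarrow> nat \<Rightarrow> nat \<Rightarrow> real" and f
  assume s: "sym_kernels {..<n} K" "sym_kernels {..<n} K'" and eq: "\<forall>v. v \<notin> range VarX \<longrightarrow> K v = K' v"
  have e: "K (VarA i) = K' (VarA i)" for i using eq by blast
  then have "midpoint_kernel K K' (VarA i) = K' (VarA i)" for i by (simp add: midpoint_kernel_def fun_eq_iff)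
  with e have "kernel_tuple n K VarA = kernel_tuple n K' VarA" "kernel_tuple n K VarA = kernel_tuple n (midpoint_kernel K K') VarA"
    by (simp_all add: kernel_tuple_def [abs_def])
  then show "qform {..<n} (coeffs_of p) (midpoint_kernel K K') f
      \<le> (qform {..<n} (coeffs_of p) K f + qform {..<n} (coeffs_of p) K' f) / 2"
    using assms[unfolded convex_in_x_def, rule_format, OF kernel_tuple_sym[OF s(1), of VarA]
        kernel_tuple_sym[OF s(1), of VarX] kernel_tuple_sym[OF s(2), of VarX], of "1/2"]
    by (intro loewner_ge_midpoint_qform) (simp add: convex_comb_kernel_tuple)
qed

lemma convex_in_a_imp_midconvex:
  assumes "convex_in_a p"
  shows "midconvex_in (range VarA) (coeffs_of p)"
  unfolding midconvex_in_def
proof (intro allI impI, elim conjE)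
  fix n :: nat and K K' :: "'a ncvar \<Rightarrow> nat \<Rightarrow> nat \<Rightarrow> real" and f
  assume s: "sym_kernels {..<n} K" "sym_kernels {..<n} K'" and eq: "\<forall>v. v \<notin> range VarA \<longrightarrow> K v = K' v"
  have e: "K (VarX i) = K' (VarX i)" for i using eq by blast
  then have "midpoint_kernel K K' (VarX i) = K' (VarX i)" for i by (simp add: midpoint_kernel_def fun_eq_iff)
  with e have "kernel_tuple n K VarX = kernel_tuple n K' VarX" "kernel_tuple n K VarX = kernel_tuple n (midpoint_kernel K K') VarX"
    by (simp_all add: kernel_tuple_def [abs_def])
  then show "qform {..<n} (coeffs_of p) (midpoint_kernel K K') f
      \<le> (qform {..<n} (coeffs_of p) K f + qform {..<n} (coeffs_of p) K' f) / 2"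
    using assms[unfolded convex_in_a_def, rule_format, OF kernel_tuple_sym[OF s(1), of VarA]
        kernel_tuple_sym[OF s(2), of VarA] kernel_tuple_sym[OF s(1), of VarX], of "1/2"]
    by (intro loewner_ge_midpoint_qform) (simp add: convex_comb_kernel_tuple)
qed

section \<open>Coefficients that convexity forces to vanish\<close>

definition count_in :: "'v set \<Rightarrow> 'v list \<Rightarrow> nat" where
  "count_in D w = length (filter (\<lambda>v. v \<in> D) w)"

lemma count_in_simps [simp]:
  "count_in D [] = 0" "count_in D (v # w) = (if v \<in> D then 1 else 0) + count_in D w" "count_in D (u @ w) = count_in D u + count_in D w"
  "count_in D (rev w) = count_in D w"
  by (simp_all add: count_in_def flip: rev_filter)

lemma count_in_mono_mset: "mset u \<subseteq># mset w \<Longrightarrow> count_in D u \<le> count_in D w"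
  unfolding count_in_def by (metis mset_filter multiset_filter_mono size_mset size_mset_mono)

lemma count_in_take_mono: "s \<le> t \<Longrightarrow> count_in D (take s w) \<le> count_in D (take t w)"
  by (auto simp: take_add dest!: le_Suc_ex)

definition rev_invariant :: "('v list \<Rightarrow> 'a) \<Rightarrow> bool" where
  "rev_invariant c \<longleftrightarrow> (\<forall>w. c (rev w) = c w)"

lemma rev_invariantD: "rev_invariant c \<Longrightarrow> c (rev w) = c w"
  by (simp add: rev_invariant_def)

definition bform ::
  "'b set \<Rightarrow> ('v list \<Rightarrow> real) \<Rightarrow> ('v \<Rightarrow> 'b \<Rightarrow> 'b \<Rightarrow> real) \<Rightarrow> ('b \<Rightarrow> real) \<Rightarrow> ('b \<Rightarrow> real) \<Rightarrow> real" where
  "bform S c K f g = (\<Sum>w\<in>support c. c w * dot S f (act S K w g))"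

lemma act_linear:
  "act S K w (\<lambda>s. t * f s + g s) = (\<lambda>s. t * act S K w f s + act S K w g s)"
proof (induction w)
  case (Cons v w)
  then show ?case by (simp add: fun_eq_iff sum_distrib_left sum.distrib distrib_left mult.left_commute)
qed (simp add: fun_eq_iff)

lemma bform_sym:
  assumes K: "sym_kernels S K" and c: "rev_invariant c"
  shows "bform S c K f g = bform S c K g f"
proof -
  have "bform S c K f g = (\<Sum>w\<in>support c. c w * dot S (act S K (rev w) f) g)"
    by (simp only: bform_def dot_act_adjoint[OF K])
  also have "\<dots> = (\<Sum>w\<in>support c. c w * dot S g (act S K (rev w) f))"
    by (simp only: dot_sym[of S _ g])
  also have "\<dots> = bform S c K g f"
    unfolding bform_def by (rule sum.reindex_bij_witness[of _ rev rev]) (simp_all add: rev_invariantD[OF c])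
  finally show ?thesis .
qed

lemma qform_linear:
  assumes K: "sym_kernels S K" and c: "rev_invariant c"
  shows "qform S c K (\<lambda>s. t * f s + g s) = t\<^sup>2 * bform S c K f f + 2 * t * bform S c K f g + bform S c K g g"
proof -
  have "dot S (\<lambda>s. t * f s + g s) (act S K w (\<lambda>s. t * f s + g s))
      = t\<^sup>2 * dot S f (act S K w f) + t * dot S f (act S K w g) + t * dot S g (act S K w f) + dot S g (act S K w g)" for w
    unfolding act_linear
    by (simp add: dot_def algebra_simps power2_eq_square sum.distrib sum_distrib_left)
  then have "qform S c K (\<lambda>s. t * f s + g s)
      = t\<^sup>2 * bform S c K f f + t * bform S c K f g + t * bform S c K g f + bform S c K g g"
    by (simp add: qform_def bform_def algebra_simps sum.distrib sum_distrib_left)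
  then show ?thesis using bform_sym[OF K c, of g f] by simp
qed

text \<open>The path with vertices \<open>0, ..., length w\<close>, whose edge from \<open>r\<close> to \<open>Suc r\<close> is labelled by the letter
\<open>w ! r\<close> and has weight \<open>c r\<close>. Entries of words at this kernel are sums over walks on the path.\<close>
definition path_kernel :: "'v list \<Rightarrow> (nat \<Rightarrow> real) \<Rightarrow> 'v \<Rightarrow> nat \<Rightarrow> nat \<Rightarrow> real" where
  "path_kernel w c v s t =
     (if t = Suc s \<and> s < length w \<and> w ! s = v then c s
      else if s = Suc t \<and> t < length w \<and> w ! t = v then c t else 0)"

definition unit_fun :: "'b \<Rightarrow> 'b \<Rightarrow> real" where
  "unit_fun b s = (if s = b then 1 else 0)"

lemma path_kernel_sym: "sym_kernels S (path_kernel w c)"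
  by (auto simp: sym_kernels_def path_kernel_def)

lemma path_kernel_nonzero:
  assumes "path_kernel w c v s t \<noteq> 0"
  obtains "t = Suc s" "s < length w" "w ! s = v" | "s = Suc t" "t < length w" "w ! t = v"
proof (cases "t = Suc s \<and> s < length w \<and> w ! s = v")
  case True
  then show ?thesis by (intro that(1)) simp_all
next
  case False
  then show ?thesis using assms by (intro that(2)) (simp_all add: path_kernel_def split: if_split_asm)
qed

lemma act_Cons_nonzero:
  assumes "act S K (v # w) f s \<noteq> 0"
  obtains t where "t \<in> S" "K v s t \<noteq> 0" "act S K w f t \<noteq> 0"
proof -
  obtain t where "t \<in> S" "K v s t * act S K w f t \<noteq> 0"
    using assms by (auto elim: sum.not_neutral_contains_not_neutral)
  then show thesis by (intro that) auto
qed

text \<open>A walk from \<open>s\<close> to the far end crosses every edge beyond \<open>s\<close>, so it spells a word that contains all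
letters of these edges.\<close>
lemma path_end_support:
  assumes "act {..length w} (path_kernel w c) u (unit_fun (length w)) s \<noteq> 0"
  shows "mset (drop s w) \<subseteq># mset u"
  using assms
proof (induction u arbitrary: s)
  case Nil
  then show ?case by (auto simp: unit_fun_def split: if_splits)
next
  case (Cons v u)
  from Cons.prems obtain t where t: "path_kernel w c v s t \<noteq> 0"
      "act {..length w} (path_kernel w c) u (unit_fun (length w)) t \<noteq> 0"
    by (rule act_Cons_nonzero)
  from Cons.IH[OF t(2)] have IH: "mset (drop t w) \<subseteq># mset u" .
  from t(1) show ?case
  proof (cases rule: path_kernel_nonzero)
    case 1
    then have "drop s w = v # drop t w" by (metis Cons_nth_drop_Suc)
    then show ?thesis using IH by simp
  next
    case 2
    then have "drop t w = v # drop s w" by (metis Cons_nth_drop_Suc)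
    then have "mset (drop s w) \<subseteq># mset (drop t w)" by (simp add: subset_mset.add_increasing2 flip: add_mset_add_single)
    also note IH
    also have "mset u \<subseteq># mset (v # u)" by simp
    finally show ?thesis .
  qed
qed

text \<open>A walk that is no longer than the distance to the far end never turns round, so it is unique and its
word is read off the path.\<close>
lemma path_end_exact:
  assumes "length u + s \<le> length w"
  shows "act {..length w} (path_kernel w c) u (unit_fun (length w)) s
    = (if u = drop s w then \<Prod>r\<in>{s..<length w}. c r else 0)"
  using assms
proof (induction u arbitrary: s)
  case Nil
  then show ?case by (auto simp: unit_fun_def)
next
  case (Cons v u)
  let ?a = "act {..length w} (path_kernel w c) u (unit_fun (length w))"
  have s: "s < length w" using Cons.prems by simp
  have backward: "?a t = 0" if "s = Suc t" for t
  proof -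
    have "length u \<noteq> length (drop t w)" using Cons.prems that by simp
    then have "u \<noteq> drop t w" by blast
    then show ?thesis using Cons.IH[of t] Cons.prems that by simp
  qed
  have "act {..length w} (path_kernel w c) (v # u) (unit_fun (length w)) s
      = (\<Sum>t\<le>length w. if t = Suc s then (if w ! s = v then c s else 0) * ?a (Suc s) else 0)"
  proof -
    have "path_kernel w c v s t * ?a t = (if t = Suc s then (if w ! s = v then c s else 0) * ?a (Suc s) else 0)" for t
      using s backward[of t] by (cases "t = Suc s") (simp_all add: path_kernel_def)
    then show ?thesis by simp
  qed
  also have "\<dots> = (if w ! s = v then c s else 0) * ?a (Suc s)"
    using s by simp
  also have "\<dots> = (if w ! s = v \<and> u = drop (Suc s) w then c s * (\<Prod>r\<in>{Suc s..<length w}. c r) else 0)"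
    using Cons.IH[of "Suc s"] Cons.prems by simp
  also have "\<dots> = (if v # u = drop s w then \<Prod>r\<in>{s..<length w}. c r else 0)"
    using s by (auto simp: Cons_nth_drop_Suc[symmetric] prod.atLeast_Suc_lessThan)
  finally show ?case .
qed

lemma path_step_count_in:
  assumes "path_kernel w c v s t \<noteq> 0"
  shows "count_in D (take t w) \<le> count_in D (take s w) + count_in D [v]"
  using assms
proof (cases rule: path_kernel_nonzero)
  case 1
  then show ?thesis by (simp add: take_Suc_conv_app_nth)
next
  case 2
  then show ?thesis using count_in_take_mono[of t s D w] by simp
qed

text \<open>Dually, a word whose walk leads from the start to \<open>s\<close> uses at least as many letters from \<open>D\<close> as the
edges in between carry.\<close>
lemma path_start_support:
  assumes "act S (path_kernel w c) u (unit_fun 0) s \<noteq> 0"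
  shows "count_in D (take s w) \<le> count_in D u"
  using assms
proof (induction u arbitrary: s)
  case Nil
  then show ?case by (auto simp: unit_fun_def split: if_splits)
next
  case (Cons v u)
  from Cons.prems obtain t where t: "path_kernel w c v s t \<noteq> 0" "act S (path_kernel w c) u (unit_fun 0) t \<noteq> 0"
    by (rule act_Cons_nonzero)
  have "path_kernel w c v t s \<noteq> 0" using t(1) by (auto simp: path_kernel_def split: if_splits)
  from path_step_count_in[OF this, of D] Cons.IH[OF t(2)] show ?case by simp
qed

text \<open>A word that is too poor in letters from \<open>D\<close> to reach vertex \<open>Suc e\<close> and still return to \<open>s\<close> cannot
notice the weights of the edges from \<open>e\<close> on. In the induction the number of letters of \<open>D\<close> already
used plus those still required to get from \<open>0\<close> to \<open>s\<close> is the potential that never decreases.\<close>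
lemma path_start_agree:
  assumes agree: "\<And>r. r < e \<Longrightarrow> c r = c' r"
    and "count_in D u + count_in D (take s w) < 2 * count_in D (take (Suc e) w)"
  shows "act S (path_kernel w c) u (unit_fun 0) s = act S (path_kernel w c') u (unit_fun 0) s"
  using assms(2)
proof (induction u arbitrary: s)
  case (Cons v u)
  let ?a = "\<lambda>c. act S (path_kernel w c) u (unit_fun 0)"
  show ?case
  proof (cases "Suc e \<le> s")
    case True
    then have "count_in D (v # u) < count_in D (take s w)"
      using Cons.prems count_in_take_mono[OF True, of D w] by linarith
    then show ?thesis using path_start_support[of S w _ "v # u" s D] by (metis not_le)
  next
    case False
    have "path_kernel w c v s t * ?a c t = path_kernel w c' v s t * ?a c' t" for t
    proof (cases "path_kernel w (\<lambda>_. 1) v s t = 0")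
      case True
      then show ?thesis by (auto simp: path_kernel_def split: if_splits)
    next
      case nz: False
      have budget: "count_in D u + count_in D (take t w) < 2 * count_in D (take (Suc e) w)"
        using path_step_count_in[OF nz, of D] Cons.prems by (auto split: if_splits)
      note IH = Cons.IH[OF budget]
      show ?thesis
      proof (cases "Suc e \<le> t")
        case True
        then have "count_in D u < count_in D (take t w)"
          using budget count_in_take_mono[OF True, of D w] by linarith
        then have "?a c t = 0" "?a c' t = 0" using path_start_support[of S w _ u t D] by (metis not_le)+
        then show ?thesis by simp
      next
        case t: False
        then have "path_kernel w c v s t = path_kernel w c' v s t"
          using \<open>\<not> Suc e \<le> s\<close> by (auto simp: path_kernel_def intro!: agree)
        then show ?thesis using IH by simp
      qed
    qed
    then show ?thesis by simp
  qed
qed simp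

lemma linear_nonneg_imp_zero:
  fixes a b :: real
  assumes "\<And>t. 0 \<le> 2 * t * a + b"
  shows "a = 0"
proof (rule ccontr)
  assume "a \<noteq> 0"
  then have "2 * (- (b + 1) / (2 * a)) * a + b = -1" by (simp add: field_simps)
  moreover have "0 \<le> 2 * (- (b + 1) / (2 * a)) * a + b" by (rule assms)
  ultimately show False by simp
qed

lemma midpoint_path_kernel:
  "midpoint_kernel (path_kernel w c) (path_kernel w c') = path_kernel w (\<lambda>r. (c r + c' r) / 2)"
  by (intro ext) (simp add: midpoint_kernel_def path_kernel_def)

text \<open>The graph is the path spelling \<open>w\<close>, and \<open>a\<close> is the common weight of the two marked edges, those of
\<open>x\<close> and \<open>y\<close>; the weights \<open>1\<close> and \<open>-1\<close> have the midpoint \<open>0\<close>. By the hypothesis on \<open>D\<close>, no word of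
the polynomial can cross the first marked edge and come back, so the form at the start does
not depend on \<open>a\<close>. Since no longer word contains all letters of \<open>w\<close>, the entry between the two ends is \<open>c w\<close> times
\<open>a\<^sup>2\<close>: it is \<open>c w\<close> at \<open>1\<close> and \<open>-1\<close>, but \<open>0\<close> at the midpoint. Applied to the vector
\<open>t e\<^sub>0 + e\<^sub>L\<close>, midpoint convexity says that an affine function of \<open>t\<close> with slope \<open>2 c w\<close> is
nonnegative.\<close>
lemma coefficient_vanishes:
  assumes mid: "midconvex_in V c" and rev: "rev_invariant c"
    and w: "w = u @ x # m @ y # z" and V: "x \<in> V" "y \<in> V"
    and D: "\<And>w'. w' \<in> support c \<Longrightarrow> count_in D w' < 2 * count_in D (u @ [x])"
    and longest: "\<And>w'. w' \<in> support c \<Longrightarrow> mset w \<subseteq># mset w' \<Longrightarrow> length w' \<le> length w"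
    and fin: "finite (support c)"
  shows "c w = 0"
proof -
  let ?L = "length w" and ?i = "length u" and ?j = "length u + Suc (length m)"
  let ?S = "{..?L}"
  define h :: "real \<Rightarrow> nat \<Rightarrow> real" where "h a r = (if r \<in> {?i, ?j} then a else 1)" for a r
  let ?K = "\<lambda>a. path_kernel w (h a)"
  let ?e0 = "unit_fun 0 :: nat \<Rightarrow> real" and ?eL = "unit_fun ?L :: nat \<Rightarrow> real"
  have letters: "w ! ?i = x" "w ! ?j = y" "?i < ?L" "?j < ?L" by (simp_all add: w nth_append)
  have start: "bform ?S c (?K a) ?e0 ?e0 = bform ?S c (?K 1) ?e0 ?e0" for a
  proof -
    have "act ?S (?K a) w' ?e0 0 = act ?S (?K 1) w' ?e0 0" if "w' \<in> support c" for w'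
      using D[OF that]
      by (intro path_start_agree[where e = ?i and D = D]) (simp_all add: h_def w)
    then show ?thesis by (simp add: bform_def dot_def unit_fun_def if_distrib[of "\<lambda>x. x * _"] cong: if_cong)
  qed
  have across: "bform ?S c (?K a) ?e0 ?eL = c w * a\<^sup>2" for a
  proof -
    have p: "(\<Prod>r<?L. h a r) = a\<^sup>2"
    proof -
      have "{..<?L} \<inter> {?i, ?j} = {?i, ?j}" using letters by auto
      then have "(\<Prod>r<?L. h a r) = (\<Prod>r\<in>{?i, ?j}. a)"
        unfolding h_def by (subst prod.inter_restrict[symmetric]) simp_all
      then show ?thesis by (simp add: power2_eq_square)
    qed
    have "act ?S (?K a) w' ?eL 0 = (if w' = w then a\<^sup>2 else 0)" if "w' \<in> support c" for w'
    proof (cases "act ?S (?K a) w' ?eL 0 = 0")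
      case True
      show ?thesis using True path_end_exact[of w 0 w "h a"] p by (auto simp: atLeast0LessThan)
    next
      case False
      then have "length w' \<le> ?L" using path_end_support[OF False] longest[OF that] by simp
      then show ?thesis using path_end_exact[of w' 0 w "h a"] p by (simp add: atLeast0LessThan)
    qed
    then have "bform ?S c (?K a) ?e0 ?eL = (\<Sum>w'\<in>support c. if w' = w then c w * a\<^sup>2 else 0)"
      by (auto simp: bform_def dot_def unit_fun_def if_distrib[of "\<lambda>x. x * _"] intro!: sum.cong cong: if_cong)
    then show ?thesis using fin by simp
  qed
  have "0 \<le> 2 * t * c w + ((bform ?S c (?K 1) ?eL ?eL + bform ?S c (?K (-1)) ?eL ?eL) / 2 - bform ?S c (?K 0) ?eL ?eL)"
    for t
  proof -
    have m: "midpoint_kernel (?K 1) (?K (-1)) = ?K 0"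
    proof -
      have "(\<lambda>r. (h 1 r + h (-1) r) / 2) = h 0" by (auto simp: h_def fun_eq_iff)
      then show ?thesis by (simp add: midpoint_path_kernel)
    qed
    have "?K 1 v = ?K (-1) v" if "v \<notin> V" for v
    proof -
      have "h 1 r = h (-1) r" if "w ! r = v" for r using that \<open>v \<notin> V\<close> V letters by (auto simp: h_def)
      then show ?thesis by (intro ext) (auto simp: path_kernel_def)
    qed
    from midconvex_inD[OF mid _ path_kernel_sym path_kernel_sym this, of ?S "\<lambda>s. t * ?e0 s + ?eL s"]
    show ?thesis
      unfolding m qform_linear[OF path_kernel_sym rev] across
      using start[of "-1"] start[of 0] by (simp add: field_simps)
  qed
  then show "c w = 0" by (rule linear_nonneg_imp_zero)
qed

lemma split_last_two:
  assumes "2 \<le> count_in V w"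
  obtains u x m y z where "w = u @ x # m @ y # z" "x \<in> V" "y \<in> V" "count_in V m = 0" "count_in V z = 0"
proof -
  have ex: "\<exists>u y z. w = u @ y # z \<and> y \<in> V \<and> count_in V z = 0" if "1 \<le> count_in V w" for w :: "'a list"
  proof -
    have "\<exists>y\<in>set w. y \<in> V" using that by (auto simp: count_in_def Suc_le_eq filter_empty_conv)
    from split_list_last_propE[OF this] show ?thesis by (metis count_in_def filter_False list.size(3))
  qed
  obtain w' y z where 1: "w = w' @ y # z" "y \<in> V" "count_in V z = 0" using ex[of w] assms by auto
  then have "1 \<le> count_in V w'" using assms by simp
  then obtain u x m where "w' = u @ x # m" "x \<in> V" "count_in V m = 0" using ex by blast
  with 1 show thesis by (intro that[of u x m y z]) auto
qed

text \<open>Let \<open>d > 2\<close> be the maximal degree in \<open>V\<close>, and choose a longest word \<open>q\<close> of this degree. Mark its last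
two letters from \<open>V\<close>: a walk across the first of them and back uses \<open>2 (d - 1) > d\<close> letters from \<open>V\<close>,
and a word containing \<open>q\<close> also has degree \<open>d\<close>, so it is not longer.\<close>
lemma midconvex_degree_le_2:
  assumes mid: "midconvex_in V c" and rev: "rev_invariant c" and fin: "finite (support c)"
    and "c w \<noteq> 0"
  shows "count_in V w \<le> 2"
proof (rule ccontr)
  assume "\<not> count_in V w \<le> 2"
  define d where "d = Max (count_in V ` support c)"
  have d: "count_in V w' \<le> d" if "w' \<in> support c" for w' using that fin by (simp add: d_def)
  let ?T = "{w' \<in> support c. count_in V w' = d}"
  have "w \<in> support c" using assms(4) by simp
  then have "d \<in> count_in V ` support c" unfolding d_def using fin by (intro Max_in) auto
  then have "?T \<noteq> {}" "finite ?T" using fin by auto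
  then have "Max (length ` ?T) \<in> length ` ?T" by (intro Max_in) auto
  then obtain q where "q \<in> ?T" "length q = Max (length ` ?T)" by auto
  with \<open>finite ?T\<close> have q: "q \<in> ?T" "\<And>w'. w' \<in> ?T \<Longrightarrow> length w' \<le> length q"
    by auto
  have "2 < d" using d[OF \<open>w \<in> support c\<close>] \<open>\<not> count_in V w \<le> 2\<close> by simp
  then have "2 \<le> count_in V q" using q(1) by simp
  then obtain u x m y z where s: "q = u @ x # m @ y # z" "x \<in> V" "y \<in> V" "count_in V m = 0" "count_in V z = 0"
    by (rule split_last_two)
  have "c q = 0"
  proof (rule coefficient_vanishes[OF mid rev s(1-3) _ _ fin, where D = V])
    fix w' assume w': "w' \<in> support c"
    have "count_in V u + 2 = d" using q(1) s by simp
    then show "count_in V w' < 2 * count_in V (u @ [x])" using d[OF w'] \<open>2 < d\<close> s(2) by simp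
    show "length w' \<le> length q" if "mset q \<subseteq># mset w'"
      using count_in_mono_mset[OF that, of V] d[OF w'] q w' by (intro q(2)) auto
  qed
  then show False using q(1) by simp
qed

section \<open>Positive semidefinite completion\<close>

definition psd_on :: "'c set \<Rightarrow> ('c \<Rightarrow> 'c \<Rightarrow> real) \<Rightarrow> bool" where
  "psd_on S G \<longleftrightarrow> (\<forall>u\<in>S. \<forall>v\<in>S. G u v = G v u) \<and> (\<forall>f. 0 \<le> (\<Sum>u\<in>S. \<Sum>v\<in>S. f u * f v * G u v))"

lemma psd_onD_sym: "psd_on S G \<Longrightarrow> u \<in> S \<Longrightarrow> v \<in> S \<Longrightarrow> G u v = G v u"
  and psd_onD: "psd_on S G \<Longrightarrow> 0 \<le> (\<Sum>u\<in>S. \<Sum>v\<in>S. f u * f v * G u v)"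
  by (simp_all add: psd_on_def)

lemma psd_on_insertD:
  assumes "psd_on (insert c S) G" "finite S" "c \<notin> S"
  shows "0 \<le> t\<^sup>2 * G c c + 2 * t * (\<Sum>u\<in>S. f u * G u c) + (\<Sum>u\<in>S. \<Sum>v\<in>S. f u * f v * G u v)"
proof -
  let ?f = "f(c := t)"
  have eq: "(\<Sum>v\<in>S. ?f v * F v) = (\<Sum>v\<in>S. f v * F v)" for F
    using assms(3) by (intro sum.cong) auto
  have "(\<Sum>u\<in>insert c S. \<Sum>v\<in>insert c S. ?f u * ?f v * G u v)
      = (\<Sum>u\<in>insert c S. ?f u * (\<Sum>v\<in>insert c S. ?f v * G u v))"
    by (simp add: sum_distrib_left mult.assoc)
  also have "\<dots> = t * (t * G c c + (\<Sum>v\<in>S. f v * G c v)) + (\<Sum>u\<in>S. f u * (t * G u c + (\<Sum>v\<in>S. f v * G u v)))"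
    using assms(2,3) by (simp only: sum.insert eq fun_upd_same not_False_eq_True)
  also have "(\<Sum>v\<in>S. f v * G c v) = (\<Sum>v\<in>S. f v * G v c)"
    using psd_onD_sym[OF assms(1)] by (intro sum.cong) auto
  also have "(\<Sum>u\<in>S. f u * (t * G u c + (\<Sum>v\<in>S. f v * G u v)))
      = t * (\<Sum>u\<in>S. f u * G u c) + (\<Sum>u\<in>S. \<Sum>v\<in>S. f u * f v * G u v)"
    by (simp add: sum_distrib_left sum.distrib algebra_simps)
  finally show ?thesis
    using psd_onD[OF assms(1), of ?f] by (simp add: algebra_simps power2_eq_square)
qed

text \<open>One step of symmetric Gaussian elimination. If the pivot \<open>G c c\<close> vanishes, the convention \<open>x / 0 = 0\<close>
makes this \<open>G u v\<close>, which is the right value: in a positive semidefinite matrix the row of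
a vanishing pivot is zero.\<close>
definition schur :: "'c \<Rightarrow> ('c \<Rightarrow> 'c \<Rightarrow> real) \<Rightarrow> 'c \<Rightarrow> 'c \<Rightarrow> real" where
  "schur c G u v = G u v - G u c * G c v / G c c"

lemma psd_on_pivot:
  assumes "psd_on (insert c S) G" "finite S" "c \<notin> S"
  shows "0 \<le> G c c" and "u \<in> insert c S \<Longrightarrow> G c c = 0 \<Longrightarrow> G u c = 0"
proof -
  show "0 \<le> G c c" using psd_on_insertD[OF assms, of 1 "\<lambda>_. 0"] by simp
  assume u: "u \<in> insert c S" and 0: "G c c = 0"
  show "G u c = 0"
  proof (cases "u = c")
    case False
    with u have "u \<in> S" by simp
    have 1: "(\<Sum>v\<in>S. (if v = u then 1 else 0) * F v) = F u" for F :: "'a \<Rightarrow> real"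
      using \<open>u \<in> S\<close> assms(2) by (simp add: if_distrib[of "\<lambda>x. x * _"] cong: if_cong)
    have "0 \<le> 2 * t * G u c + G u u" for t
      using psd_on_insertD[OF assms, of t "\<lambda>v. if v = u then 1 else 0"] 0
      by (simp add: 1 mult.assoc flip: sum_distrib_left)
    then show ?thesis by (rule linear_nonneg_imp_zero)
  qed (use 0 in simp)
qed

text \<open>The Schur complement is the minimum of the form over the coordinate at \<open>c\<close>; it is attained at
\<open>- b / G c c\<close>, where \<open>b\<close> is the linear part of the form in this coordinate, halved.\<close>
lemma psd_on_schur:
  assumes "psd_on (insert c S) G" "finite S" "c \<notin> S"
  shows "psd_on S (schur c G)"
  unfolding psd_on_def
proof (intro conjI ballI allI)
  fix u v assume "u \<in> S" "v \<in> S"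
  then show "schur c G u v = schur c G v u"
    using psd_onD_sym[OF assms(1)] by (simp add: schur_def mult.commute)
next
  fix f :: "'a \<Rightarrow> real"
  define b where "b = (\<Sum>u\<in>S. f u * G u c)"
  have "b * b / G c c = (\<Sum>u\<in>S. \<Sum>v\<in>S. f u * f v * (G u c * G c v / G c c))"
  proof -
    have "(\<Sum>u\<in>S. \<Sum>v\<in>S. f u * f v * (G u c * G c v / G c c)) = (\<Sum>u\<in>S. \<Sum>v\<in>S. (f u * G u c) * (f v * G v c)) / G c c"
      using psd_onD_sym[OF assms(1)]
      by (simp add: sum_divide_distrib ac_simps)
    then show ?thesis by (simp add: b_def sum_product)
  qed
  moreover have "0 \<le> (- b / G c c)\<^sup>2 * G c c + 2 * (- b / G c c) * b + (\<Sum>u\<in>S. \<Sum>v\<in>S. f u * f v * G u v)"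
    using psd_on_insertD[OF assms] unfolding b_def by blast
  moreover have "(- b / G c c)\<^sup>2 * G c c + 2 * (- b / G c c) * b = - (b * b / G c c)"
    by (cases "G c c = 0") (simp_all add: field_simps power2_eq_square)
  ultimately show "0 \<le> (\<Sum>u\<in>S. \<Sum>v\<in>S. f u * f v * schur c G u v)"
    by (simp add: schur_def right_diff_distrib sum_subtractf)
qed

lemma schur_pivot:
  assumes "psd_on (insert c S) G" "finite S" "c \<notin> S" "u \<in> insert c S" "v \<in> insert c S"
  shows "G u v = (if u = c \<or> v = c then 0 else schur c G u v) + G u c / sqrt (G c c) * (G v c / sqrt (G c c))"
proof -
  note p = psd_on_pivot[OF assms(1-3)]
  have "G u c / sqrt (G c c) * (G v c / sqrt (G c c)) = G u c * G c v / G c c"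
    using p(1) psd_onD_sym[OF assms(1,5), of c] by simp
  then show ?thesis
    using p(2)[OF assms(4)] p(2)[OF assms(5)] psd_onD_sym[OF assms(1,5), of c]
    by (cases "G c c = 0") (auto simp: schur_def)
qed

lemma psd_on_factor:
  assumes "finite S" "psd_on S G"
  shows "\<exists>l. \<forall>u\<in>S. \<forall>v\<in>S. G u v = (\<Sum>k\<in>S. l k u * l k v)"
  using assms
proof (induction S arbitrary: G rule: finite_induct)
  case (insert c S)
  obtain l where l: "\<And>u v. u \<in> S \<Longrightarrow> v \<in> S \<Longrightarrow> schur c G u v = (\<Sum>k\<in>S. l k u * l k v)"
    using insert.IH[OF psd_on_schur[OF insert.prems insert.hyps]] by blast
  define l' where "l' k u = (if k = c then G u c / sqrt (G c c) else if u = c then 0 else l k u)" for k u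
  have "G u v = (\<Sum>k\<in>insert c S. l' k u * l' k v)" if "u \<in> insert c S" "v \<in> insert c S" for u v
  proof -
    have "(\<Sum>k\<in>S. l' k u * l' k v) = (\<Sum>k\<in>S. if u = c \<or> v = c then 0 else l k u * l k v)"
      using insert.hyps(2) by (intro sum.cong) (auto simp: l'_def)
    also have "\<dots> = (if u = c \<or> v = c then 0 else schur c G u v)"
      using l[of u v] that by auto
    finally show ?thesis
      using schur_pivot[OF insert.prems insert.hyps that] insert.hyps by (simp add: l'_def)
  qed
  then show ?case by blast
qed simp

text \<open>Eliminate the common indices \<open>C\<close> one at a time. Each step subtracts a matrix of rank one,
and the step on one block agrees with the step on the other where they overlap, so the smaller blocks
again satisfy the hypotheses. Once \<open>C\<close> is
exhausted, the entries between \<open>P\<close> and \<open>Q\<close> may be taken to be zero.\<close>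
lemma psd_completion:
  assumes "finite C" "finite P" "finite Q" "P \<inter> Q = {}" "C \<inter> (P \<union> Q) = {}"
    and "psd_on (C \<union> P) G" "psd_on (C \<union> Q) G"
  obtains H where "psd_on (C \<union> P \<union> Q) H"
    "\<And>u v. u \<in> C \<union> P \<Longrightarrow> v \<in> C \<union> P \<Longrightarrow> H u v = G u v"
    "\<And>u v. u \<in> C \<union> Q \<Longrightarrow> v \<in> C \<union> Q \<Longrightarrow> H u v = G u v"
proof -
  have "\<exists>H. psd_on (C \<union> P \<union> Q) H \<and> (\<forall>u\<in>C \<union> P. \<forall>v\<in>C \<union> P. H u v = G u v) \<and> (\<forall>u\<in>C \<union> Q. \<forall>v\<in>C \<union> Q. H u v = G u v)"
    using assms(1,5-)
  proof (induction C arbitrary: G rule: finite_induct)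
    case empty
    define H where "H u v = (if (u \<in> P \<longleftrightarrow> v \<in> P) then G u v else 0)" for u v
    have "(\<Sum>u\<in>P \<union> Q. \<Sum>v\<in>P \<union> Q. f u * f v * H u v)
        = (\<Sum>u\<in>P. \<Sum>v\<in>P. f u * f v * G u v) + (\<Sum>u\<in>Q. \<Sum>v\<in>Q. f u * f v * G u v)" for f
    proof -
      have "(\<Sum>v\<in>P \<union> Q. f u * f v * H u v) = (\<Sum>v\<in>P. f u * f v * G u v)" if "u \<in> P" for u
        using assms(2-4) that by (subst sum.union_disjoint) (auto simp: H_def intro!: sum.neutral)
      moreover have "(\<Sum>v\<in>P \<union> Q. f u * f v * H u v) = (\<Sum>v\<in>Q. f u * f v * G u v)" if "u \<in> Q" for u
      proof -
        have "u \<notin> P" "\<And>v. v \<in> Q \<Longrightarrow> v \<notin> P" using that assms(4) by auto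
        then show ?thesis
          using assms(2-4) by (subst sum.union_disjoint) (auto simp: H_def intro!: sum.neutral)
      qed
      ultimately show ?thesis using assms(2-4) by (simp add: sum.union_disjoint)
    qed
    moreover have "H u v = H v u" if "u \<in> P \<union> Q" "v \<in> P \<union> Q" for u v
      using that empty psd_onD_sym[of P G u v] psd_onD_sym[of Q G u v] by (auto simp: H_def)
    ultimately have "psd_on (P \<union> Q) H"
      using psd_onD[of P G] psd_onD[of Q G] empty by (simp add: psd_on_def)
    moreover have "H u v = G u v" if "u \<in> P \<and> v \<in> P \<or> u \<in> Q \<and> v \<in> Q" for u v
      using that assms(4) by (auto simp: H_def)
    ultimately show ?case by auto
  next
    case (insert c C)
    let ?S = "C \<union> P \<union> Q"
    have fin: "finite (C \<union> P)" "finite (C \<union> Q)" "finite ?S" using insert.hyps assms(2,3) by auto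
    have c: "c \<notin> C \<union> P" "c \<notin> C \<union> Q" "c \<notin> ?S" using insert.hyps insert.prems(1) by auto
    have GP: "psd_on (insert c (C \<union> P)) G" and GQ: "psd_on (insert c (C \<union> Q)) G"
      using insert.prems by simp_all
    obtain H where H: "psd_on ?S H" "\<And>u v. u \<in> C \<union> P \<Longrightarrow> v \<in> C \<union> P \<Longrightarrow> H u v = schur c G u v"
       "\<And>u v. u \<in> C \<union> Q \<Longrightarrow> v \<in> C \<union> Q \<Longrightarrow> H u v = schur c G u v"
      using insert.IH[OF _ psd_on_schur[OF GP fin(1) c(1)] psd_on_schur[OF GQ fin(2) c(2)]] insert.prems(1)
      by auto
    define r where "r u = G u c / sqrt (G c c)" for u
    define H' where "H' u v = (if u = c \<or> v = c then 0 else H u v) + r u * r v" for u v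
    have "psd_on (insert c ?S) H'"
      unfolding psd_on_def
    proof (intro conjI ballI allI)
      fix u v assume "u \<in> insert c ?S" "v \<in> insert c ?S"
      then show "H' u v = H' v u" using psd_onD_sym[OF H(1), of u v] by (auto simp: H'_def)
    next
      fix f :: "'a \<Rightarrow> real"
      have "(\<Sum>u\<in>insert c ?S. \<Sum>v\<in>insert c ?S. f u * f v * (if u = c \<or> v = c then 0 else H u v))
          = (\<Sum>u\<in>?S. \<Sum>v\<in>?S. f u * f v * H u v)"
      proof -
        have "u \<noteq> c" if "u \<in> ?S" for u using that c(3) by auto
        then show ?thesis using fin(3) c(3) by simp
      qed
      moreover have "(\<Sum>u\<in>insert c ?S. \<Sum>v\<in>insert c ?S. f u * f v * (r u * r v)) = (\<Sum>u\<in>insert c ?S. f u * r u)\<^sup>2"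
        unfolding power2_eq_square sum_product by (simp add: ac_simps)
      ultimately show "0 \<le> (\<Sum>u\<in>insert c ?S. \<Sum>v\<in>insert c ?S. f u * f v * H' u v)"
        unfolding H'_def distrib_left sum.distrib using psd_onD[OF H(1), of f] by simp
    qed
    moreover have "H' u v = G u v" if "u \<in> insert c (C \<union> P)" "v \<in> insert c (C \<union> P)" for u v
      using schur_pivot[OF GP fin(1) c(1) that] H(2)[of u v] that by (auto simp: H'_def r_def)
    moreover have "H' u v = G u v" if "u \<in> insert c (C \<union> Q)" "v \<in> insert c (C \<union> Q)" for u v
      using schur_pivot[OF GQ fin(2) c(2) that] H(3)[of u v] that by (auto simp: H'_def r_def)
    ultimately show ?case by (intro exI[of _ H']) simp
  qed
  then show thesis using that by blast
qed

section \<open>Gram matrices by duality\<close>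

text \<open>Suppose there is no such \<open>G\<close>. The coefficients then lie outside the convex cone of all vectors of
the form \<open>\<Sum> G u v\<close> with \<open>G\<close> positive semidefinite. To have a compact set to separate from, only the convex
hull of the matrices \<open>f f\<^sup>T\<close> with \<open>|f|\<^sup>2 \<le> R\<close> is considered, where \<open>R\<close> exceeds the trace \<open>t\<close> that the
coefficients prescribe. This trace is prescribed because, by \<open>diag\<close>, a word \<open>rev (b u) @ b u\<close>
arises from no other pair; for the same reason \<open>\<tau>\<close>, the indicator of these words, has the identity as its
Hankel matrix. Adding a suitable multiple of \<open>\<tau>\<close> to the separating functional makes its Hankel
matrix positive definite and keeps its value on the coefficients negative.\<close>
lemma gram_by_duality:
  fixes b :: "'i::finite \<Rightarrow> 'v list" and c :: "'v list \<Rightarrow> real"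
  defines "W \<equiv> range (\<lambda>(u, v). rev (b u) @ b v)"
  assumes c: "rev_invariant c"
    and diag: "\<And>u v v'. rev (b v) @ b v' = rev (b u) @ b u \<Longrightarrow> v = u \<and> v' = u"
    and pos: "\<And>l \<delta>. \<lbrakk>rev_invariant l; 0 < \<delta>;
        \<And>f. \<delta> * (\<Sum>u\<in>UNIV. (f u)\<^sup>2) \<le> (\<Sum>u\<in>UNIV. \<Sum>v\<in>UNIV. f u * f v * l (rev (b u) @ b v))\<rbrakk>
      \<Longrightarrow> 0 \<le> (\<Sum>w\<in>W. c w * l w)"
  shows "\<exists>G. psd_on UNIV G \<and> (\<forall>w\<in>W. c w = (\<Sum>(u, v) | rev (b u) @ b v = w. G u v))"
proof -
  define m where "m q = rev (b (fst q)) @ b (snd q)" for q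
  have W: "W = range m" by (simp add: W_def m_def case_prod_beta)
  have pair_sum: "(\<Sum>u\<in>UNIV. \<Sum>v\<in>UNIV. F u v) = (\<Sum>q\<in>UNIV. F (fst q) (snd q))" for F :: "'i \<Rightarrow> 'i \<Rightarrow> real"
    by (simp add: sum.cartesian_product case_prod_beta)
  have m_swap: "m (prod.swap q) = rev (m q)" for q by (simp add: m_def)
  have filt: "(\<Sum>q | B q. F q) = (\<Sum>q\<in>UNIV. if B q then F q else 0)" for B and F :: "'i \<times> 'i \<Rightarrow> real"
    using sum.inter_filter[of UNIV F B] by simp
  define P :: "real ^ ('i \<times> 'i)" where "P = (\<chi> q. c (m q))"
  define \<Phi> :: "real ^ 'i \<Rightarrow> real ^ ('i \<times> 'i)" where
    "\<Phi> f = (\<chi> q. \<Sum>q' | m q' = m q. vec_nth f (fst q') * vec_nth f (snd q'))" for f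
  define \<tau> :: "'v list \<Rightarrow> real" where "\<tau> w = (if \<exists>u. w = rev (b u) @ b u then 1 else 0)" for w
  have \<tau>_rev: "rev_invariant \<tau>"
    unfolding rev_invariant_def \<tau>_def by (metis rev_append rev_rev_ident)
  have \<tau>_m: "\<tau> (m q) = (if fst q = snd q then 1 else 0)" for q
    using diag[of "fst q" "snd q"] by (auto simp: \<tau>_def m_def)
  have trace: "(\<Sum>q\<in>UNIV. f (fst q) * f (snd q) * \<tau> (m q)) = (\<Sum>u\<in>UNIV. (f u)\<^sup>2)" for f :: "'i \<Rightarrow> real"
    unfolding \<tau>_m pair_sum[of "\<lambda>u v. f u * f v * (if u = v then 1 else 0)", symmetric]
    by (simp add: power2_eq_square if_distrib[of "\<lambda>x. _ * x"] cong: if_cong)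
  define t where "t = (\<Sum>w\<in>W. c w * \<tau> w)"
  define R where "R = \<bar>t\<bar> + 2"
  have R: "0 < R" by (simp add: R_def)
  define T where "T = convex hull (\<Phi> ` cball 0 (sqrt R))"
  have "P \<in> T"
  proof (rule ccontr)
    assume "P \<notin> T"
    have "continuous_on (cball 0 (sqrt R)) \<Phi>"
      unfolding \<Phi>_def by (intro continuous_intros continuous_on_vec_lambda)
    then have "compact T" unfolding T_def
      by (intro compact_convex_hull compact_continuous_image) auto
    then obtain a \<beta> where a: "inner a P < \<beta>" "\<And>y. y \<in> T \<Longrightarrow> \<beta> < inner a y"
      using separating_hyperplane_closed_point[of T P] \<open>P \<notin> T\<close>
      by (auto simp: T_def compact_imp_closed)
    define l0 where "l0 w = (\<Sum>q | m q = w. vec_nth a q)" for w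
    have l0_c: "(\<Sum>w\<in>W. c w * l0 w) = inner a P"
    proof -
      have "inner a P = (\<Sum>q\<in>UNIV. c (m q) * vec_nth a q)"
        by (simp add: inner_vec_def P_def mult.commute)
      also have "\<dots> = (\<Sum>w\<in>W. \<Sum>q | q \<in> UNIV \<and> m q = w. c (m q) * vec_nth a q)"
        unfolding W by (rule sum.image_gen) simp
      also have "\<dots> = (\<Sum>w\<in>W. c w * l0 w)"
        by (intro sum.cong) (auto simp: l0_def sum_distrib_left)
      finally show ?thesis by simp
    qed
    have l0_\<Phi>: "(\<Sum>q\<in>UNIV. vec_nth f (fst q) * vec_nth f (snd q) * l0 (m q)) = inner a (\<Phi> f)" for f
    proof -
      let ?F = "\<lambda>q. vec_nth f (fst q) * vec_nth f (snd q)"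
      have "inner a (\<Phi> f) = (\<Sum>q\<in>UNIV. \<Sum>q'\<in>UNIV. if m q' = m q then vec_nth a q * ?F q' else 0)"
        by (simp add: inner_vec_def \<Phi>_def filt sum_distrib_left if_distrib cong: if_cong)
      also have "\<dots> = (\<Sum>q'\<in>UNIV. \<Sum>q\<in>UNIV. if m q = m q' then vec_nth a q * ?F q' else 0)"
        by (subst sum.swap) (simp add: eq_commute)
      also have "\<dots> = (\<Sum>q'\<in>UNIV. ?F q' * l0 (m q'))"
        by (simp add: l0_def filt sum_distrib_left if_distrib mult.commute cong: if_cong)
      finally show ?thesis by simp
    qed
    \<comment> \<open>Reversal exchanges the two entries of a pair, so symmetrising only doubles both values.\<close>
    define l where "l w = l0 w + l0 (rev w)" for w
    have l_rev: "rev_invariant l" by (simp add: rev_invariant_def l_def)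
    have "(\<Sum>w\<in>W. c w * l0 (rev w)) = (\<Sum>w\<in>W. c w * l0 w)"
    proof -
      have "rev w \<in> W" if "w \<in> W" for w using that m_swap by (metis W imageE rangeI)
      then show ?thesis
        by (intro sum.reindex_bij_witness[of _ rev rev]) (simp_all add: rev_invariantD[OF c])
    qed
    then have l_c: "(\<Sum>w\<in>W. c w * l w) = 2 * inner a P"
      by (simp add: l_def distrib_left sum.distrib l0_c)
    have l_\<Phi>: "(\<Sum>q\<in>UNIV. vec_nth f (fst q) * vec_nth f (snd q) * l (m q)) = 2 * inner a (\<Phi> f)" for f
    proof -
      have "(\<Sum>q\<in>UNIV. vec_nth f (fst q) * vec_nth f (snd q) * l0 (rev (m q)))
          = (\<Sum>q\<in>UNIV. vec_nth f (fst q) * vec_nth f (snd q) * l0 (m q))"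
        by (rule sum.reindex_bij_witness[of _ prod.swap prod.swap]) (simp_all add: m_swap)
      then show ?thesis by (simp add: l_def distrib_left sum.distrib l0_\<Phi>)
    qed
    have ball: "\<beta> < inner a (\<Phi> f)" if "norm f \<le> sqrt R" for f
      using that by (intro a(2)) (auto simp: T_def intro!: hull_inc)
    have "\<Phi> 0 = 0" by (simp add: \<Phi>_def vec_eq_iff)
    then have \<beta>: "\<beta> < 0" using ball[of 0] R by simp
    \<comment> \<open>Of the form \<open>- 2 * \<beta> / s\<close> with \<open>t < s < R\<close>: the first bound keeps the value on the coefficients negative, the second makes the Hankel matrix definite.\<close>
    define \<kappa> where "\<kappa> = - 2 * \<beta> / (\<bar>t\<bar> + 1)"
    define \<delta> where "\<delta> = \<kappa> + 2 * \<beta> / R"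
    have "\<delta> > 0"
    proof -
      have "\<delta> = - 2 * \<beta> * (1 / (\<bar>t\<bar> + 1) - 1 / (\<bar>t\<bar> + 2))" by (simp add: \<delta>_def \<kappa>_def R_def algebra_simps)
      moreover have "1 / (\<bar>t\<bar> + 2) < 1 / (\<bar>t\<bar> + 1)" by (intro divide_strict_left_mono) auto
      ultimately show ?thesis using \<beta> by (simp add: mult_neg_pos)
    qed
    have scaled: "2 * \<beta> / R * (\<Sum>u\<in>UNIV. (f u)\<^sup>2) \<le> (\<Sum>q\<in>UNIV. f (fst q) * f (snd q) * l (m q))" for f
    proof (cases "(\<Sum>u\<in>UNIV. (f u)\<^sup>2) = 0")
      case True
      then have "f u = 0" for u by (simp add: sum_nonneg_eq_0_iff)
      then show ?thesis by simp
    next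
      case False
      define N where "N = (\<Sum>u\<in>UNIV. (f u)\<^sup>2)"
      have N: "N > 0" using False by (simp add: N_def less_le sum_nonneg)
      define s where "s = sqrt (R / N)"
      have s: "s\<^sup>2 = R / N" using N R by (simp add: s_def)
      let ?g = "\<chi> u. s * f u"
      have "norm ?g = sqrt (\<Sum>u\<in>UNIV. s\<^sup>2 * (f u)\<^sup>2)"
        by (simp add: norm_vec_def L2_set_def power_mult_distrib)
      also have "(\<Sum>u\<in>UNIV. s\<^sup>2 * (f u)\<^sup>2) = s\<^sup>2 * N" by (simp add: N_def sum_distrib_left)
      also have "\<dots> = R" using N by (simp add: s)
      finally have "2 * \<beta> \<le> (\<Sum>q\<in>UNIV. vec_nth ?g (fst q) * vec_nth ?g (snd q) * l (m q))"
        unfolding l_\<Phi> using ball[of ?g] by simp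
      also have "\<dots> = s\<^sup>2 * (\<Sum>q\<in>UNIV. f (fst q) * f (snd q) * l (m q))"
        by (simp add: sum_distrib_left power2_eq_square ac_simps)
      finally show ?thesis using N R by (simp add: s field_simps flip: N_def)
    qed
    let ?l = "\<lambda>w. l w + \<kappa> * \<tau> w"
    have "0 \<le> (\<Sum>w\<in>W. c w * ?l w)"
    proof (rule pos[OF _ \<open>0 < \<delta>\<close>])
      show "rev_invariant ?l" using l_rev \<tau>_rev by (simp add: rev_invariant_def)
      fix f :: "'i \<Rightarrow> real"
      have "(\<Sum>u\<in>UNIV. \<Sum>v\<in>UNIV. f u * f v * ?l (rev (b u) @ b v))
         = (\<Sum>q\<in>UNIV. f (fst q) * f (snd q) * l (m q)) + \<kappa> * (\<Sum>q\<in>UNIV. f (fst q) * f (snd q) * \<tau> (m q))"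
        by (subst pair_sum) (simp add: distrib_left sum.distrib sum_distrib_left ac_simps flip: m_def)
      then show "\<delta> * (\<Sum>u\<in>UNIV. (f u)\<^sup>2) \<le> (\<Sum>u\<in>UNIV. \<Sum>v\<in>UNIV. f u * f v * ?l (rev (b u) @ b v))"
        unfolding trace using scaled[of f] by (simp add: \<delta>_def distrib_right)
    qed
    also have "(\<Sum>w\<in>W. c w * ?l w) = 2 * inner a P + \<kappa> * t"
      by (simp add: distrib_left sum.distrib l_c t_def sum_distrib_left mult.left_commute)
    also have "\<dots> < 2 * \<beta> + \<kappa> * t" using a(1) by simp
    also have "\<dots> = 2 * \<beta> * ((\<bar>t\<bar> + 1 - t) / (\<bar>t\<bar> + 1))"
      by (simp add: \<kappa>_def field_simps)
    also have "\<dots> \<le> 0"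
    proof (rule mult_nonpos_nonneg)
      show "0 \<le> (\<bar>t\<bar> + 1 - t) / (\<bar>t\<bar> + 1)" by (intro divide_nonneg_pos) auto
    qed (use \<beta> in simp)
    finally show False by simp
  qed
  then obtain Y \<mu> where Y: "finite Y" "Y \<subseteq> \<Phi> ` cball 0 (sqrt R)" "\<And>y. y \<in> Y \<Longrightarrow> 0 \<le> \<mu> y"
      and P: "P = (\<Sum>y\<in>Y. \<mu> y *\<^sub>R y)"
    unfolding T_def convex_hull_explicit by auto
  then have "\<forall>y\<in>Y. \<exists>f. y = \<Phi> f" by auto
  then obtain F where F: "\<And>y. y \<in> Y \<Longrightarrow> y = \<Phi> (F y)" by metis
  define G where "G u v = (\<Sum>y\<in>Y. \<mu> y * (vec_nth (F y) u * vec_nth (F y) v))" for u v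
  have "psd_on UNIV G"
    unfolding psd_on_def
  proof (intro conjI ballI allI)
    fix f :: "'i \<Rightarrow> real"
    have "(\<Sum>u\<in>UNIV. \<Sum>v\<in>UNIV. f u * f v * G u v)
        = (\<Sum>u\<in>UNIV. \<Sum>v\<in>UNIV. \<Sum>y\<in>Y. \<mu> y * ((f u * vec_nth (F y) u) * (f v * vec_nth (F y) v)))"
      by (simp add: G_def sum_distrib_left ac_simps)
    also have "\<dots> = (\<Sum>y\<in>Y. \<Sum>u\<in>UNIV. \<Sum>v\<in>UNIV. \<mu> y * ((f u * vec_nth (F y) u) * (f v * vec_nth (F y) v)))"
      by (subst sum.swap, subst (2) sum.swap) (rule refl)
    also have "\<dots> = (\<Sum>y\<in>Y. \<mu> y * (\<Sum>u\<in>UNIV. f u * vec_nth (F y) u)\<^sup>2)"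
      unfolding power2_eq_square sum_product by (simp add: sum_distrib_left)
    also have "0 \<le> \<dots>" using Y(3) by (intro sum_nonneg) simp
    finally show "0 \<le> (\<Sum>u\<in>UNIV. \<Sum>v\<in>UNIV. f u * f v * G u v)" .
  qed (simp add: G_def mult.commute)
  moreover have "c (m q) = (\<Sum>(u, v) | rev (b u) @ b v = m q. G u v)" for q
  proof -
    have "c (m q) = vec_nth P q" by (simp add: P_def)
    also have "\<dots> = (\<Sum>y\<in>Y. \<mu> y * vec_nth (\<Phi> (F y)) q)"
      unfolding P by (simp add: F[symmetric])
    also have "\<dots> = (\<Sum>y\<in>Y. \<Sum>q' | m q' = m q. \<mu> y * (vec_nth (F y) (fst q') * vec_nth (F y) (snd q')))"
      by (simp add: \<Phi>_def sum_distrib_left)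
    also have "\<dots> = (\<Sum>q' | m q' = m q. G (fst q') (snd q'))"
      unfolding G_def by (rule sum.swap)
    finally show ?thesis by (simp add: m_def case_prod_unfold)
  qed
  ultimately show ?thesis by (intro exI[of _ G]) (auto simp: W)
qed

section \<open>Positivity against Hankel functionals\<close>

text \<open>The words \<open>x\<^sub>j\<close>, \<open>a\<^sub>k x\<^sub>j\<close> and \<open>x\<^sub>j a\<^sub>k\<close>, as a finite type of indices; \<open>border_word\<close> spells them for any
two families of letters, so that the families can be exchanged.\<close>
datatype 'g border = One 'g | Pre 'g 'g | Post 'g 'g

instance border :: (finite) finite
proof
  have "(UNIV :: 'a border set) = range One \<union> range (case_prod Pre) \<union> range (case_prod Post)"
  proof (intro subset_antisym subsetI UNIV_I)
    fix b :: "'a border"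
    show "b \<in> range One \<union> range (case_prod Pre) \<union> range (case_prod Post)"
      by (cases b) (auto intro: image_eqI[of _ _ "(_, _)"])
  qed
  then show "finite (UNIV :: 'a border set)" by (metis finite_Un finite_class.finite_UNIV finite_imageI)
qed

fun border_word :: "('g \<Rightarrow> 'v) \<Rightarrow> ('g \<Rightarrow> 'v) \<Rightarrow> 'g border \<Rightarrow> 'v list" where
  "border_word X A (One j) = [X j]"
| "border_word X A (Pre k j) = [A k, X j]"
| "border_word X A (Post j k) = [X j, A k]"

lemma sum_UNIV_Plus:
  "(\<Sum>t\<in>UNIV. F t) = (\<Sum>a\<in>UNIV. F (Inl a)) + (\<Sum>b\<in>UNIV. F (Inr b))"
  for F :: "'a::finite + 'b::finite \<Rightarrow> real"
  by (simp add: sum.Plus flip: UNIV_Plus_UNIV)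

text \<open>Negating the kernels of the letters in \<open>V\<close> gives the midpoint at which they vanish. A word of degree
\<open>n\<close> in \<open>V\<close> then contributes with the factor \<open>(1 + (-1)\<^sup>n) / 2 - 0\<^sup>n\<close>, and among \<open>n \<le> 2\<close> only \<open>n = 2\<close>
survives, with factor one.\<close>
lemma hessian_nonneg:
  assumes mid: "midconvex_in V c" and deg: "\<And>w. c w \<noteq> 0 \<Longrightarrow> count_in V w \<le> 2" and "finite S"
    and K: "sym_kernels S K" and fin: "finite (support c)"
  shows "0 \<le> (\<Sum>w | c w \<noteq> 0 \<and> count_in V w = 2. c w * dot S f (act S K w f))"
proof -
  define h :: "real \<Rightarrow> 'a \<Rightarrow> 'b \<Rightarrow> 'b \<Rightarrow> real" where "h a v s t = (if v \<in> V then a * K v s t else K v s t)" for a v s t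
  have act: "act S (h a) w f s = a ^ count_in V w * act S K w f s" for a w s
    by (induction w arbitrary: s) (simp_all add: h_def sum_distrib_left ac_simps)
  have q: "qform S c (h a) f = (\<Sum>w\<in>support c. c w * (a ^ count_in V w * dot S f (act S K w f)))" for a
    unfolding qform_def dot_def act sum_distrib_left by (simp add: ac_simps)
  have h: "sym_kernels S (h a)" for a using K by (simp add: sym_kernels_def h_def)
  have "h 1 v = h (-1) v" if "v \<notin> V" for v using that by (simp add: h_def fun_eq_iff)
  from midconvex_inD[OF mid \<open>finite S\<close> h h this, of f]
  have "qform S c (midpoint_kernel (h 1) (h (-1))) f \<le> (qform S c (h 1) f + qform S c (h (-1)) f) / 2" .
  moreover have "midpoint_kernel (h 1) (h (-1)) = h 0"
    by (simp add: midpoint_kernel_def h_def fun_eq_iff)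
  ultimately have "0 \<le> (qform S c (h 1) f + qform S c (h (-1)) f) / 2 - qform S c (h 0) f" by simp
  also have "\<dots> = (\<Sum>w\<in>support c. ((1 + (-1) ^ count_in V w) / 2 - 0 ^ count_in V w) * (c w * dot S f (act S K w f)))"
    unfolding q sum_divide_distrib sum.distrib[symmetric] sum_subtractf[symmetric]
    by (intro sum.cong) (simp_all add: field_simps)
  also have "\<dots> = (\<Sum>w\<in>support c. if count_in V w = 2 then c w * dot S f (act S K w f) else 0)"
  proof (intro sum.cong refl)
    fix w assume "w \<in> support c"
    then have "count_in V w = 0 \<or> count_in V w = 1 \<or> count_in V w = 2" using deg[of w] by auto
    then show "((1 + (-1) ^ count_in V w) / 2 - 0 ^ count_in V w) * (c w * dot S f (act S K w f))
        = (if count_in V w = 2 then c w * dot S f (act S K w f) else 0)" by auto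
  qed
  also have "\<dots> = (\<Sum>w | w \<in> support c \<and> count_in V w = 2. c w * dot S f (act S K w f))"
    by (rule sum.inter_filter[OF fin, symmetric])
  finally show ?thesis by simp
qed

text \<open>A symmetric matrix \<open>N\<close> with \<open>N \<xi>\<^sub>j = \<omega>\<^sub>j\<close> for vectors \<open>\<xi>\<^sub>j\<close> with a dual family \<open>\<eta>\<close>. The matrix
\<open>\<Sum> (\<omega>\<^sub>j \<eta>\<^sub>j\<^sup>T + \<eta>\<^sub>j \<omega>\<^sub>j\<^sup>T)\<close> is symmetric and maps \<open>\<xi>\<^sub>l\<close> to \<open>\<omega>\<^sub>l\<close> plus a combination of the \<open>\<eta>\<^sub>j\<close>, and the double
sum removes this excess.\<close>
lemma symmetric_interpolation:
  fixes \<xi> \<omega> \<eta> :: "'j::finite \<Rightarrow> 'e::finite \<Rightarrow> real"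
  assumes dual: "\<And>i j. dot UNIV (\<eta> i) (\<xi> j) = (if i = j then 1 else 0)"
    and sym: "\<And>i j. dot UNIV (\<omega> i) (\<xi> j) = dot UNIV (\<omega> j) (\<xi> i)"
  obtains N where "\<And>s t. N s t = N t s" "\<And>j s. (\<Sum>t\<in>UNIV. N s t * \<xi> j t) = \<omega> j s"
proof
  let ?g = "\<lambda>i j. dot UNIV (\<omega> i) (\<xi> j)"
  let ?N = "\<lambda>s t. (\<Sum>j\<in>UNIV. \<omega> j s * \<eta> j t) + (\<Sum>j\<in>UNIV. \<eta> j s * \<omega> j t)
      - (\<Sum>i\<in>UNIV. \<Sum>j\<in>UNIV. ?g i j * \<eta> i s * \<eta> j t)"
  show "?N s t = ?N t s" for s t
  proof -
    have "(\<Sum>i\<in>UNIV. \<Sum>j\<in>UNIV. ?g i j * \<eta> i s * \<eta> j t) = (\<Sum>j\<in>UNIV. \<Sum>i\<in>UNIV. ?g i j * \<eta> i s * \<eta> j t)"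
      by (rule sum.swap)
    also have "\<dots> = (\<Sum>i\<in>UNIV. \<Sum>j\<in>UNIV. ?g i j * \<eta> i t * \<eta> j s)"
      by (intro sum.cong refl) (simp only: sym ac_simps)
    finally show ?thesis by (simp add: mult.commute)
  qed
  show "(\<Sum>t\<in>UNIV. ?N s t * \<xi> l t) = \<omega> l s" for l s
  proof -
    have "(\<Sum>t\<in>UNIV. ?N s t * \<xi> l t) = (\<Sum>t\<in>UNIV. \<Sum>j\<in>UNIV. \<omega> j s * (\<eta> j t * \<xi> l t))
        + (\<Sum>t\<in>UNIV. \<Sum>j\<in>UNIV. \<eta> j s * (\<omega> j t * \<xi> l t))
        - (\<Sum>t\<in>UNIV. \<Sum>i\<in>UNIV. \<Sum>j\<in>UNIV. ?g i j * \<eta> i s * (\<eta> j t * \<xi> l t))"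
      by (simp add: distrib_right left_diff_distrib sum.distrib sum_subtractf sum_distrib_right mult.assoc)
    also have "(\<Sum>t\<in>UNIV. \<Sum>j\<in>UNIV. \<omega> j s * (\<eta> j t * \<xi> l t)) = (\<Sum>j\<in>UNIV. \<omega> j s * dot UNIV (\<eta> j) (\<xi> l))"
      by (subst sum.swap) (simp add: dot_def sum_distrib_left)
    also have "(\<Sum>t\<in>UNIV. \<Sum>j\<in>UNIV. \<eta> j s * (\<omega> j t * \<xi> l t)) = (\<Sum>j\<in>UNIV. \<eta> j s * ?g j l)"
      by (subst sum.swap) (simp add: dot_def sum_distrib_left)
    also have "(\<Sum>t\<in>UNIV. \<Sum>i\<in>UNIV. \<Sum>j\<in>UNIV. ?g i j * \<eta> i s * (\<eta> j t * \<xi> l t))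
        = (\<Sum>i\<in>UNIV. \<Sum>j\<in>UNIV. ?g i j * \<eta> i s * dot UNIV (\<eta> j) (\<xi> l))"
      unfolding dot_def[of _ "\<eta> _"] sum_distrib_left by (subst sum.swap, subst (2) sum.swap) (rule refl)
    also have "\<dots> = (\<Sum>j\<in>UNIV. \<eta> j s * ?g j l)"
      unfolding dual by (simp add: if_distrib[of "\<lambda>x. _ * x"] cong: if_cong) (simp add: mult.commute)
    finally show ?thesis unfolding dual by (simp add: if_distrib[of "\<lambda>x. _ * x"] cong: if_cong)
  qed
qed

text \<open>The space is the sum of a small space with basis \<open>1\<close> (index \<open>None\<close>) and \<open>a\<^sub>k\<close> (index \<open>Some k\<close>) and of
a space that holds a vector \<open>\<xi> u\<close> for each border \<open>u\<close>. The letter \<open>x\<^sub>j\<close> maps \<open>1\<close> to \<open>\<xi> x\<^sub>j\<close> and \<open>a\<^sub>k\<close> to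
\<open>\<xi> (x\<^sub>j a\<^sub>k)\<close>, and symmetry determines its values on the second space. The letter \<open>a\<^sub>k\<close> exchanges
\<open>1\<close> and \<open>a\<^sub>k\<close>, kills the other basis vectors of the small space, and acts by \<open>N k\<close> on the second space.\<close>
definition gns_coupling :: "('g \<Rightarrow> 'v) \<Rightarrow> ('g border \<Rightarrow> 'e \<Rightarrow> real) \<Rightarrow> 'v \<Rightarrow> 'g option \<Rightarrow> 'e \<Rightarrow> real" where
  "gns_coupling X \<xi> v a s =
     (if v \<in> range X then (case a of None \<Rightarrow> \<xi> (One (inv_into UNIV X v)) s | Some k \<Rightarrow> \<xi> (Post (inv_into UNIV X v) k) s) else 0)"

fun gns_kernel :: "('g \<Rightarrow> 'v) \<Rightarrow> ('g \<Rightarrow> 'v) \<Rightarrow> ('g border \<Rightarrow> 'e \<Rightarrow> real) \<Rightarrow> ('g \<Rightarrow> 'e \<Rightarrow> 'e \<Rightarrow> real)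
    \<Rightarrow> 'v \<Rightarrow> 'g option + 'e \<Rightarrow> 'g option + 'e \<Rightarrow> real" where
  "gns_kernel X A \<xi> N v (Inl a) (Inl b) =
     (if v \<in> range A \<and> (a = None \<and> b = Some (inv_into UNIV A v) \<or> a = Some (inv_into UNIV A v) \<and> b = None) then 1 else 0)"
| "gns_kernel X A \<xi> N v (Inr s) (Inr t) = (if v \<in> range A then N (inv_into UNIV A v) s t else 0)"
| "gns_kernel X A \<xi> N v (Inl a) (Inr s) =
     gns_coupling X \<xi> v a s"
| "gns_kernel X A \<xi> N v (Inr s) (Inl a) = gns_coupling X \<xi> v a s"

lemma gns_kernel_sym:
  assumes "\<And>k s t. N k s t = N k t s"
  shows "sym_kernels UNIV (gns_kernel X A \<xi> N)"
proof -
  have "gns_kernel X A \<xi> N v s t = gns_kernel X A \<xi> N v t s" for v s t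
    using assms by (cases s; cases t) auto
  then show ?thesis by (simp add: sym_kernels_def)
qed

text \<open>Every border, applied to the cyclic vector, gives its own vector, provided that \<open>N k\<close> maps \<open>\<xi> x\<^sub>j\<close>
to \<open>\<xi> (a\<^sub>k x\<^sub>j)\<close>. Hence the vector state has the value \<open>\<langle>\<xi> u, \<xi> v\<rangle>\<close> at \<open>u\<^sup>T v\<close>.\<close>
lemma act_gns_kernel:
  fixes X A :: "'g::finite \<Rightarrow> 'v" and N :: "'g \<Rightarrow> 'e::finite \<Rightarrow> 'e \<Rightarrow> real"
  assumes "inj X" "inj A" "range X \<inter> range A = {}"
    and N: "\<And>k j s. (\<Sum>t\<in>UNIV. N k s t * \<xi> (One j) t) = \<xi> (Pre k j) s"
  shows "act UNIV (gns_kernel X A \<xi> N) (border_word X A u) (unit_fun (Inl None))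
    = (\<lambda>s. case s of Inl _ \<Rightarrow> 0 | Inr s \<Rightarrow> \<xi> u s)"
proof -
  let ?K = "gns_kernel X A \<xi> N"
  have XA: "X j \<notin> range A" "A k \<notin> range X" for j k using assms(3) by auto
  have first: "act UNIV ?K [v] (unit_fun b) = (\<lambda>s. ?K v s b)" for v b
    by (simp add: fun_eq_iff unit_fun_def if_distrib[of "\<lambda>x. _ * x"] cong: if_cong)
  have X: "act UNIV ?K [X j] (unit_fun (Inl a)) = (\<lambda>s. case s of Inl _ \<Rightarrow> 0 | Inr s \<Rightarrow> (case a of None \<Rightarrow> \<xi> (One j) s | Some k \<Rightarrow> \<xi> (Post j k) s))" for a j
    unfolding first using XA assms(1) by (auto simp: fun_eq_iff gns_coupling_def split: sum.split option.split)
  show ?thesis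
  proof (cases u)
    case (One j)
    show ?thesis unfolding One border_word.simps X by (simp add: fun_eq_iff split: sum.split)
  next
    case (Pre k j)
    have "act UNIV ?K [A k, X j] (unit_fun (Inl None)) = act UNIV ?K [A k] (act UNIV ?K [X j] (unit_fun (Inl None)))"
      by (simp add: act_append[of _ _ "[A k]" "[X j]", simplified])
    also have "\<dots> = (\<lambda>s. case s of Inl _ \<Rightarrow> 0 | Inr s \<Rightarrow> \<xi> (Pre k j) s)"
      unfolding X using XA assms(2) N by (auto simp: fun_eq_iff gns_coupling_def sum_UNIV_Plus split: sum.split)
    finally show ?thesis unfolding Pre border_word.simps .
  next
    case (Post j k)
    have "act UNIV ?K [X j, A k] (unit_fun (Inl None)) = act UNIV ?K [X j] (act UNIV ?K [A k] (unit_fun (Inl None)))"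
      by (simp add: act_append[of _ _ "[X j]" "[A k]", simplified])
    also have "act UNIV ?K [A k] (unit_fun (Inl None)) = unit_fun (Inl (Some k))"
      unfolding first
    proof
      show "?K (A k) s (Inl None) = unit_fun (Inl (Some k)) s" for s
        using XA assms(2) by (cases s) (auto simp: unit_fun_def gns_coupling_def)
    qed
    finally show ?thesis unfolding Post border_word.simps X by (simp add: fun_eq_iff split: sum.split)
  qed
qed

text \<open>Vectors \<open>\<xi> u\<close> with the Gram matrix \<open>l (u\<^sup>T v)\<close> turn \<open>l\<close> into a vector state. They are built from a
factorisation of this matrix minus \<open>\<delta>\<close> times the identity, and the identity is put back as an
orthonormal second component; this makes the dual family \<open>\<eta>\<close> that interpolation asks for explicit.
Interpolation also needs \<open>\<langle>\<xi> (a\<^sub>k x\<^sub>i), \<xi> x\<^sub>j\<rangle>\<close> to be symmetric in \<open>i\<close> and \<open>j\<close>; this inner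
product is \<open>l (x\<^sub>i a\<^sub>k x\<^sub>j)\<close>, so it is the invariance of \<open>l\<close> under reversal.\<close>
lemma gns_positivity:
  fixes X A :: "'g::finite \<Rightarrow> 'v" and c l :: "'v list \<Rightarrow> real"
  defines "b \<equiv> border_word X A"
  defines "W \<equiv> range (\<lambda>(u, v). rev (b u) @ b v)"
  assumes XA: "inj X" "inj A" "range X \<inter> range A = {}"
    and mid: "midconvex_in (range X) c" and fin: "finite (support c)"
    and deg: "\<And>w. c w \<noteq> 0 \<Longrightarrow> count_in (range X) w \<le> 2"
    and shape: "\<And>w. c w \<noteq> 0 \<Longrightarrow> count_in (range X) w = 2 \<Longrightarrow> w \<in> W"
    and l: "rev_invariant l" and \<delta>: "0 < \<delta>"
    and pd: "\<And>f. \<delta> * (\<Sum>u\<in>UNIV. (f u)\<^sup>2) \<le> (\<Sum>u\<in>UNIV. \<Sum>v\<in>UNIV. f u * f v * l (rev (b u) @ b v))"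
  shows "0 \<le> (\<Sum>w\<in>W. c w * l w)"
proof -
  define \<Gamma> where "\<Gamma> u v = l (rev (b u) @ b v) - (if u = v then \<delta> else 0)" for u v
  have "psd_on UNIV \<Gamma>"
    unfolding psd_on_def
  proof (intro conjI ballI allI)
    show "\<Gamma> u v = \<Gamma> v u" for u v
      using rev_invariantD[OF l, of "rev (b u) @ b v"] by (simp add: \<Gamma>_def)
    show "0 \<le> (\<Sum>u\<in>UNIV. \<Sum>v\<in>UNIV. f u * f v * \<Gamma> u v)" for f
      using pd[of f]
      by (simp add: \<Gamma>_def right_diff_distrib sum_subtractf if_distrib[of "\<lambda>x. _ * x"] sum_distrib_left
          power2_eq_square mult.commute mult.left_commute cong: if_cong)
  qed
  from psd_on_factor[OF finite this]
  obtain p :: "'g border \<Rightarrow> 'g border \<Rightarrow> real" where lam: "\<And>u v. \<Gamma> u v = (\<Sum>k\<in>UNIV. p k u * p k v)"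
    by blast
  define \<xi> where "\<xi> u s = (case s of Inl k \<Rightarrow> p k u | Inr r \<Rightarrow> if r = u then sqrt \<delta> else 0)"
    for u :: "'g border" and s :: "'g border + 'g border"
  have gram: "dot UNIV (\<xi> u) (\<xi> v) = l (rev (b u) @ b v)" for u v
    using \<delta> lam[of u v]
    by (cases "u = v") (simp_all add: dot_def sum_UNIV_Plus \<xi>_def \<Gamma>_def if_distrib[of "\<lambda>x. _ * x"] if_distrib[of "\<lambda>x. x * _"] cong: if_cong)
  define \<eta> where "\<eta> j s = (case s of Inl _ \<Rightarrow> 0 | Inr r \<Rightarrow> if r = One j then 1 / sqrt \<delta> else 0)"
    for j :: 'g and s :: "'g border + 'g border"
  have "\<forall>k. \<exists>N. (\<forall>s t. N s t = N t s) \<and> (\<forall>j s. (\<Sum>t\<in>UNIV. N s t * \<xi> (One j) t) = \<xi> (Pre k j) s)"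
  proof (rule allI, rule symmetric_interpolation)
    fix k
    show "dot UNIV (\<eta> i) (\<xi> (One j)) = (if i = j then 1 else 0)" for i j
    proof -
      have "dot UNIV (\<eta> i) (\<xi> (One j)) = (\<Sum>r\<in>UNIV. \<eta> i (Inr r) * \<xi> (One j) (Inr r))"
        by (simp add: dot_def sum_UNIV_Plus \<eta>_def)
      also have "\<dots> = (\<Sum>r\<in>UNIV. if r = One i then (if i = j then 1 else 0) else 0)"
        using \<delta> by (intro sum.cong) (auto simp: \<eta>_def \<xi>_def)
      finally show ?thesis by simp
    qed
    show "dot UNIV (\<xi> (Pre k i)) (\<xi> (One j)) = dot UNIV (\<xi> (Pre k j)) (\<xi> (One i))" for i j
      unfolding gram using rev_invariantD[OF l, of "[X i, A k, X j]"] by (simp add: b_def)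
  qed blast
  from choice[OF this] obtain N where
    "\<forall>k. (\<forall>s t. N k s t = N k t s) \<and> (\<forall>j s. (\<Sum>t\<in>UNIV. N k s t * \<xi> (One j) t) = \<xi> (Pre k j) s)" ..
  then have N: "N k s t = N k t s" "(\<Sum>t\<in>UNIV. N k s t * \<xi> (One j) t) = \<xi> (Pre k j) s" for k s t j
    by blast+
  let ?K = "gns_kernel X A \<xi> N" and ?e = "unit_fun (Inl None) :: 'g option + _ \<Rightarrow> real"
  note K_sym = gns_kernel_sym[of N, OF N(1)]
  have state: "dot UNIV ?e (act UNIV ?K w ?e) = l w" if "w \<in> W" for w
  proof -
    from that obtain u v where w: "w = rev (b u) @ b v" by (auto simp: W_def)
    have "dot UNIV ?e (act UNIV ?K w ?e) = dot UNIV (act UNIV ?K (b u) ?e) (act UNIV ?K (b v) ?e)"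
      unfolding w act_append using dot_act_adjoint[OF K_sym, where w = "rev (b u)"] by simp
    also have "\<dots> = dot UNIV (\<xi> u) (\<xi> v)"
      unfolding b_def act_gns_kernel[OF XA N(2)] by (simp add: dot_def sum_UNIV_Plus)
    finally show ?thesis by (simp add: gram w)
  qed
  have two: "count_in (range X) w = 2" if "w \<in> W" for w
  proof -
    have "A k \<notin> range X" for k using XA(3) by auto
    then have "count_in (range X) (b u) = 1" for u by (cases u) (simp_all add: b_def)
    then show ?thesis using that by (auto simp: W_def)
  qed
  have "0 \<le> (\<Sum>w | c w \<noteq> 0 \<and> count_in (range X) w = 2. c w * dot UNIV ?e (act UNIV ?K w ?e))"
    by (rule hessian_nonneg[OF mid deg _ K_sym fin]) simp_all
  also have "\<dots> = (\<Sum>w | c w \<noteq> 0 \<and> count_in (range X) w = 2. c w * l w)"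
    using shape state by (intro sum.cong) auto
  also have "\<dots> = (\<Sum>w\<in>W. c w * l w)"
    using shape two by (intro sum.mono_neutral_left) (auto simp: W_def)
  finally show ?thesis .
qed

section \<open>The Gram matrix of the quadratic part\<close>

text \<open>The polynomial is midpoint convex in the letters \<open>X\<close> and has degree at most two in \<open>X\<close> and in \<open>A\<close>.
The two interpretations use \<open>x\<close> and \<open>a\<close> in either order.\<close>
locale two_alphabets =
  fixes X A :: "'g::finite \<Rightarrow> 'v" and c :: "'v list \<Rightarrow> real"
  assumes inj: "inj X" "inj A" and disjoint: "range X \<inter> range A = {}" and exhaust: "range X \<union> range A = UNIV"
    and fin: "finite (support c)" and rev: "rev_invariant c"
    and mid: "midconvex_in (range X) c"
    and deg_X: "\<And>w. c w \<noteq> 0 \<Longrightarrow> count_in (range X) w \<le> 2"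
    and deg_A: "\<And>w. c w \<noteq> 0 \<Longrightarrow> count_in (range A) w \<le> 2"
begin

abbreviation "borders \<equiv> range (border_word X A)"

lemma letters_distinct [simp]: "X j \<notin> range A" "A k \<notin> range X" "X j \<noteq> A k" "A k \<noteq> X j"
  using disjoint by auto

lemma letters_eq [simp]: "X i = X j \<longleftrightarrow> i = j" "A k = A l \<longleftrightarrow> k = l"
  using inj by (simp_all add: inj_eq)

lemma length_eq_count_in: "length w = count_in (range X) w + count_in (range A) w"
proof (induction w)
  case (Cons v w)
  have "v \<in> range X \<and> v \<notin> range A \<or> v \<notin> range X \<and> v \<in> range A" using exhaust disjoint by blast
  then show ?case using Cons by auto
qed simp

lemma A_word_cases:
  assumes "count_in (range X) m = 0" "length m \<le> 2"
  shows "m = [] \<or> (\<exists>k. m = [A k]) \<or> (\<exists>k l. m = [A k, A l])"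
proof -
  have "v \<notin> range X" if "v \<in> set m" for v using assms(1) that by (auto simp: count_in_def filter_empty_conv)
  then have "set m \<subseteq> range A" using exhaust by blast
  then show ?thesis using assms(2) by (cases m; cases "tl m") auto
qed

text \<open>Crossing the first \<open>X\<close> and coming back to the start takes four letters from \<open>A\<close>, but words of the
polynomial have at most two.\<close>
lemma coeff_AAXX: "c [A i, A j, X k, X l] = 0"
proof (rule coefficient_vanishes[OF mid rev _ _ _ _ _ fin, where u = "[A i, A j]" and m = "[]" and z = "[]" and D = "range A"])
  fix w' assume "w' \<in> support c"
  then have "count_in (range X) w' \<le> 2" "count_in (range A) w' \<le> 2" using deg_X deg_A by auto
  then show "count_in (range A) w' < 2 * count_in (range A) ([A i, A j] @ [X k])"
    and "length w' \<le> length [A i, A j, X k, X l]"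
    by (simp_all add: length_eq_count_in[of w'])
qed auto

lemma coeff_XXAA: "c [X l, X k, A j, A i] = 0"
  using coeff_AAXX[of i j k l] rev_invariantD[OF rev, of "[A i, A j, X k, X l]"] by simp

text \<open>The two letters from \<open>X\<close> are surrounded by at most two letters from \<open>A\<close>. If these are not both in
front or both behind, the word splits into two borders between the letters from \<open>X\<close>.\<close>
lemma border_product:
  assumes "c w \<noteq> 0" "count_in (range X) w = 2"
  shows "w \<in> range (\<lambda>(u, v). rev (border_word X A u) @ border_word X A v)"
proof -
  define W where "W = range (\<lambda>(u, v). rev (border_word X A u) @ border_word X A v)"
  have W: "rev (border_word X A u) @ border_word X A v \<in> W" for u v by (auto simp: W_def)
  have "2 \<le> count_in (range X) w" using assms(2) by simp
  then obtain u x m y z where w: "w = u @ x # m @ y # z" and xy: "x \<in> range X" "y \<in> range X"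
    and 0: "count_in (range X) m = 0" "count_in (range X) z = 0" by (rule split_last_two)
  obtain i j where ij: "x = X i" "y = X j" using xy by auto
  have u: "count_in (range X) u = 0" using assms(2) 0 by (simp add: w ij)
  have len: "length u + length m + length z \<le> 2"
    using deg_A[OF assms(1)] length_eq_count_in[of w] assms(2) by (simp add: w)
  have shapes: "v = [] \<or> (\<exists>k. v = [A k]) \<or> (\<exists>k l. v = [A k, A l])" if "v \<in> {u, m, z}" for v
    using that u 0 len by (intro A_word_cases) auto
  have W': "[X i, X j] \<in> W" "[X i, A k, X j] \<in> W" "[X i, X j, A k] \<in> W" "[A k, X i, X j] \<in> W"
    "[X i, A k, A l, X j] \<in> W" "[X i, A k, X j, A l] \<in> W" "[A k, X i, A l, X j] \<in> W" "[A k, X i, X j, A l] \<in> W" for k l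
    using W[of "One i" "One j"] W[of "One i" "Pre k j"] W[of "One i" "Post j k"] W[of "Post i k" "One j"]
      W[of "Pre k i" "Pre l j"] W[of "Pre k i" "Post j l"] W[of "Post i k" "Pre l j"] W[of "Post i k" "Post j l"]
    by simp_all
  have "w \<in> W"
    using shapes[of u, simplified] shapes[of m, simplified] shapes[of z, simplified]
    by (elim disjE exE) (use len assms(1) in \<open>simp_all add: w ij coeff_AAXX coeff_XXAA W'\<close>)
  then show ?thesis by (simp only: W_def)
qed

lemma border_word_inj: "border_word X A u = border_word X A v \<longleftrightarrow> u = v"
  by (cases u; cases v) auto

lemma border_square_unique:
  assumes "rev (border_word X A v) @ border_word X A v' = rev (border_word X A u) @ border_word X A u"
  shows "v = u \<and> v' = u"
  using assms by (cases u; cases v; cases v') auto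

lemma border_gram:
  obtains G where "psd_on borders G"
    "\<And>w. count_in (range X) w = 2 \<Longrightarrow> c w = (\<Sum>(u, v) | u \<in> borders \<and> v \<in> borders \<and> rev u @ v = w. G u v)"
proof -
  let ?b = "border_word X A" and ?W = "range (\<lambda>(u, v). rev (border_word X A u) @ border_word X A v)"
  have "\<exists>G. psd_on UNIV G \<and> (\<forall>w\<in>?W. c w = (\<Sum>(u, v) | rev (?b u) @ ?b v = w. G u v))"
  proof (rule gram_by_duality[OF rev border_square_unique])
    show "0 \<le> (\<Sum>w\<in>?W. c w * l w)"
      if "rev_invariant l" "0 < \<delta>"
        "\<And>f. \<delta> * (\<Sum>u\<in>UNIV. (f u)\<^sup>2) \<le> (\<Sum>u\<in>UNIV. \<Sum>v\<in>UNIV. f u * f v * l (rev (?b u) @ ?b v))" for l \<delta>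
      by (rule gns_positivity[OF inj disjoint mid fin deg_X border_product that])
  qed
  then obtain G where G: "psd_on UNIV G" "\<And>w. w \<in> ?W \<Longrightarrow> c w = (\<Sum>(u, v) | rev (?b u) @ ?b v = w. G u v)"
    by blast
  have inj_b: "inj ?b" by (simp add: inj_on_def border_word_inj)
  let ?i = "inv_into UNIV ?b"
  show thesis
  proof (rule that[of "\<lambda>u v. G (?i u) (?i v)"])
    show "psd_on borders (\<lambda>u v. G (?i u) (?i v))"
      using G(1) unfolding psd_on_def
      by (simp add: sum.reindex[OF inj_b] inj_b)
    fix w :: "'v list" assume 2: "count_in (range X) w = 2"
    let ?pairs = "{(u, v). u \<in> borders \<and> v \<in> borders \<and> rev u @ v = w}"
    have eq: "(\<Sum>(u, v)\<in>?pairs. G (?i u) (?i v)) = (\<Sum>(u, v) | rev (?b u) @ ?b v = w. G u v)"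
      by (rule sum.reindex_bij_witness[of _ "\<lambda>(u, v). (?b u, ?b v)" "\<lambda>(u, v). (?i u, ?i v)"])
        (auto simp: inj_b)
    show "c w = (\<Sum>(u, v)\<in>?pairs. G (?i u) (?i v))"
    proof (cases "w \<in> ?W")
      case True
      then show ?thesis using G(2) eq by simp
    next
      case False
      then have "c w = 0" using border_product 2 by blast
      moreover have "?pairs = {}" using False by auto
      ultimately show ?thesis by (simp only: sum.empty)
    qed
  qed
qed

end

section \<open>Sums of squares of polynomials\<close>

lemma lookup_involution: "Poly_Mapping.lookup (involution p) w = Poly_Mapping.lookup p (rev_word w)"
proof -
  have inv: "rev_word (rev_word u) = u" for u :: "'b word" by (simp add: rev_word_def)
  have "Poly_Mapping.lookup (involution p) w
      = (\<Sum>u\<in>Poly_Mapping.keys p. if u = rev_word w then Poly_Mapping.lookup p u else 0)"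
    unfolding involution_def lookup_sum lookup_single when_def
    by (intro sum.cong refl if_cong) (auto simp: inv)
  then show ?thesis by (simp add: in_keys_iff)
qed

lemma rev_invariant_coeffs:
  assumes "symmetric_ncpoly p"
  shows "rev_invariant (coeffs_of p)"
proof -
  have "coeffs_of p (rev w) = coeffs_of p w" for w
    using lookup_involution[of p "Word w"] assms
    by (simp add: symmetric_ncpoly_def coeffs_of_def rev_word_def)
  then show ?thesis by (simp add: rev_invariant_def)
qed

lemma degree_in_le_iff: "degree_in V p \<le> d \<longleftrightarrow> (\<forall>w. coeffs_of p w \<noteq> 0 \<longrightarrow> count_in V w \<le> d)"
  unfolding degree_in_def keys_eq_Word_support by (auto simp: count_in_def)

definition combination :: "'v list set \<Rightarrow> ('v list \<Rightarrow> real) \<Rightarrow> 'v word \<Rightarrow>\<^sub>0 real" where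
  "combination B l = (\<Sum>u\<in>B. Poly_Mapping.single (Word u) (l u))"

lemma coeffs_of_combination:
  assumes "finite B"
  shows "coeffs_of (combination B l) w = (if w \<in> B then l w else 0)"
  unfolding coeffs_of_def combination_def lookup_sum lookup_single when_def
  using assms by simp

lemma coeffs_of_combination_square:
  assumes "finite B"
  shows "coeffs_of (involution (combination B l) * combination B l) w
    = (\<Sum>(u, v) | u \<in> B \<and> v \<in> B \<and> rev u @ v = w. l u * l v)"
proof -
  have "involution (combination B l) = (\<Sum>u\<in>B. Poly_Mapping.single (Word (rev u)) (l u))"
  proof (rule poly_mapping_eqI)
    fix w
    have "Poly_Mapping.lookup (involution (combination B l)) w = (\<Sum>u\<in>B. if u = rev (letters w) then l u else 0)"
      unfolding lookup_involution combination_def lookup_sum lookup_single when_def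
      by (simp add: rev_word_def)
    also have "\<dots> = Poly_Mapping.lookup (\<Sum>u\<in>B. Poly_Mapping.single (Word (rev u)) (l u)) w"
      unfolding lookup_sum lookup_single when_def
      by (intro sum.cong refl if_cong) (auto simp: word.expand)
    finally show "Poly_Mapping.lookup (involution (combination B l)) w
        = Poly_Mapping.lookup (\<Sum>u\<in>B. Poly_Mapping.single (Word (rev u)) (l u)) w" .
  qed
  then have "involution (combination B l) * combination B l
      = (\<Sum>u\<in>B. \<Sum>v\<in>B. Poly_Mapping.single (Word (rev u @ v)) (l u * l v))"
    by (simp add: combination_def sum_product mult_single plus_word_def)
  then have "coeffs_of (involution (combination B l) * combination B l) w
      = (\<Sum>u\<in>B. \<Sum>v\<in>B. if rev u @ v = w then l u * l v else 0)"
    by (simp add: coeffs_of_def lookup_sum lookup_single when_def)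
  also have "\<dots> = (\<Sum>(u, v)\<in>B \<times> B. if rev u @ v = w then l u * l v else 0)"
    by (simp add: sum.cartesian_product)
  also have "\<dots> = (\<Sum>(u, v)\<in>{q \<in> B \<times> B. rev (fst q) @ snd q = w}. l u * l v)"
    using assms by (subst sum.inter_filter) (auto intro!: sum.cong)
  also have "{q \<in> B \<times> B. rev (fst q) @ snd q = w} = {(u, v). u \<in> B \<and> v \<in> B \<and> rev u @ v = w}"
    by auto
  finally show ?thesis .
qed

lemma (in two_alphabets) borders_eq:
  "borders = range (\<lambda>j. [X j]) \<union> range (\<lambda>(k, j). [A k, X j]) \<union> range (\<lambda>(j, k). [X j, A k])"
proof (intro subset_antisym subsetI)
  fix u assume "u \<in> borders"
  then obtain b where "u = border_word X A b" by blast
  then show "u \<in> range (\<lambda>j. [X j]) \<union> range (\<lambda>(k, j). [A k, X j]) \<union> range (\<lambda>(j, k). [X j, A k])"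
    by (cases b) auto
next
  have "[X j] \<in> borders" "[A k, X j] \<in> borders" "[X j, A k] \<in> borders" for j k
    using rangeI[of "border_word X A" "One j"] rangeI[of "border_word X A" "Pre k j"]
      rangeI[of "border_word X A" "Post j k"] by simp_all
  then show "u \<in> borders"
    if "u \<in> range (\<lambda>j. [X j]) \<union> range (\<lambda>(k, j). [A k, X j]) \<union> range (\<lambda>(j, k). [X j, A k])" for u
    using that by (elim UnE) auto
qed

lemma (in two_alphabets) count_in_border: "u \<in> borders \<Longrightarrow> count_in (range X) u = 1"
  unfolding borders_eq by auto

text \<open>Outside the borders the indices in \<open>B\<close> have degree zero in \<open>X\<close>, so only pairs of borders can produce
a word of degree two or more in \<open>X\<close>. Its degree is then exactly two, where the Gram matrix of the quadratic part gives the right coefficient.\<close>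
lemma (in two_alphabets) residual_degree:
  assumes B: "borders \<subseteq> B" "\<And>u. u \<in> B \<Longrightarrow> u \<notin> borders \<Longrightarrow> count_in (range X) u = 0"
    and G: "\<And>w. count_in (range X) w = 2 \<Longrightarrow> c w = (\<Sum>(u, v) | u \<in> borders \<and> v \<in> borders \<and> rev u @ v = w. G u v)"
    and H: "\<And>u v. u \<in> borders \<Longrightarrow> v \<in> borders \<Longrightarrow> H u v = G u v"
    and w: "c w \<noteq> (\<Sum>(u, v) | u \<in> B \<and> v \<in> B \<and> rev u @ v = w. H u v)"
  shows "count_in (range X) w \<le> 1"
proof (rule ccontr)
  assume "\<not> count_in (range X) w \<le> 1"
  then have ge: "2 \<le> count_in (range X) w" by simp
  have pairs: "{(u, v). u \<in> B \<and> v \<in> B \<and> rev u @ v = w} = {(u, v). u \<in> borders \<and> v \<in> borders \<and> rev u @ v = w}"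
  proof -
    have "u \<in> borders \<and> v \<in> borders" if "u \<in> B" "v \<in> B" "rev u @ v = w" for u v
    proof -
      have "count_in (range X) u + count_in (range X) v = count_in (range X) w" using that(3) by auto
      moreover have "count_in (range X) q \<le> 1" if "q \<in> B" for q
        using B(2)[OF that] count_in_border[of q] by fastforce
      ultimately have "count_in (range X) u \<noteq> 0" "count_in (range X) v \<noteq> 0" using that(1,2) ge by force+
      then show ?thesis using B(2)[of u] B(2)[of v] that(1,2) by auto
    qed
    then show ?thesis using B(1) by auto
  qed
  show False
  proof (cases "count_in (range X) w = 2")
    case True
    have "(\<Sum>(u, v) | u \<in> B \<and> v \<in> B \<and> rev u @ v = w. H u v) = (\<Sum>(u, v) | u \<in> borders \<and> v \<in> borders \<and> rev u @ v = w. G u v)"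
      unfolding pairs using H by (intro sum.cong) auto
    then show False using w G[OF True] by simp
  next
    case False
    have "count_in (range X) w = 2" if "u \<in> borders" "v \<in> borders" "rev u @ v = w" for u v
      using count_in_border that by auto
    then have "{(u, v). u \<in> borders \<and> v \<in> borders \<and> rev u @ v = w} = {}" using False by blast
    then have "(\<Sum>(u, v) | u \<in> B \<and> v \<in> B \<and> rev u @ v = w. H u v) = 0" unfolding pairs by (simp only: sum.empty)
    moreover have "c w = 0" using deg_X[of w] False ge by force
    ultimately show False using w by simp
  qed
qed

theorem theorem1p7:
  fixes p :: "('g::finite) ncpoly"
  assumes "symmetric_ncpoly p"
    and "convex_in_a p"
    and "convex_in_x p"
  shows "\<exists>(m::nat) (L :: 'g ncpoly) (\<Lambda> :: nat \<Rightarrow> 'g ncpoly).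
           degree_x L \<le> 1 \<and> degree_a L \<le> 1 \<and>
           (\<forall>j\<in>{1..m}. degree_x (\<Lambda> j) \<le> 1 \<and> degree_a (\<Lambda> j) \<le> 1) \<and>
           p = L + (\<Sum>j=1..m. involution (\<Lambda> j) * \<Lambda> j)"
proof -
  let ?c = "coeffs_of p"
  note rev = rev_invariant_coeffs[OF assms(1)]
  note mid_x = convex_in_x_imp_midconvex[OF assms(3)] and mid_a = convex_in_a_imp_midconvex[OF assms(2)]
  note deg_x = midconvex_degree_le_2[OF mid_x rev finite_support_coeffs]
    and deg_a = midconvex_degree_le_2[OF mid_a rev finite_support_coeffs]
  have all: "range VarX \<union> range VarA = (UNIV :: 'g ncvar set)" "range VarX \<inter> range VarA = ({} :: 'g ncvar set)"
    by (auto intro: ncvar.exhaust) (metis UNIV_I image_eqI ncvar.exhaust)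
  interpret x: two_alphabets VarX VarA ?c
    using all rev mid_x deg_x deg_a by unfold_locales (auto simp: inj_def)
  interpret a: two_alphabets VarA VarX ?c
    using all rev mid_a deg_x deg_a by unfold_locales (auto simp: inj_def)
  obtain Gx where Gx: "psd_on x.borders Gx"
    "\<And>w. count_in (range VarX) w = 2 \<Longrightarrow> ?c w = (\<Sum>(u, v) | u \<in> x.borders \<and> v \<in> x.borders \<and> rev u @ v = w. Gx u v)"
    by (rule x.border_gram) blast
  obtain Ga where Ga: "psd_on a.borders Ga"
    "\<And>w. count_in (range VarA) w = 2 \<Longrightarrow> ?c w = (\<Sum>(u, v) | u \<in> a.borders \<and> v \<in> a.borders \<and> rev u @ v = w. Ga u v)"
    by (rule a.border_gram) blast
  \<comment> \<open>\<open>C\<close> are the borders shared by both families, \<open>P\<close> and \<open>Q\<close> the single letters.\<close>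
  define C where "C = range (\<lambda>(j, k). [VarX j, VarA k]) \<union> range (\<lambda>(j, k). [VarA j, VarX k :: 'g ncvar])"
  define P where "P = range (\<lambda>j. [VarX j :: 'g ncvar])"
  define Q where "Q = range (\<lambda>j. [VarA j :: 'g ncvar])"
  have bx: "x.borders = C \<union> P"
    unfolding x.borders_eq C_def P_def by (simp only: Un_ac)
  have ba: "a.borders = C \<union> Q"
    unfolding a.borders_eq C_def Q_def by (simp only: Un_ac)
  have fin: "finite C" "finite P" "finite Q" by (simp_all add: C_def P_def Q_def)
  have disj: "P \<inter> Q = {}" "C \<inter> (P \<union> Q) = {}" by (auto simp: C_def P_def Q_def)
  have len: "length u = 2" if "u \<in> C" for u using that by (auto simp: C_def)
  have count_C: "count_in (range VarX) u = 1" "count_in (range VarA) u = 1" if "u \<in> C" for u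
    using x.count_in_border a.count_in_border that bx ba by auto
  \<comment> \<open>On borders of length two a product determines its factors, so both matrices are given by the coefficients.\<close>
  have common: "Gx u v = Ga u v" if "u \<in> C" "v \<in> C" for u v
  proof -
    have single: "{(u', v'). u' \<in> B \<and> v' \<in> B \<and> rev u' @ v' = rev u @ v} = {(u, v)}"
      if B: "C \<subseteq> B" "\<And>q. q \<in> B \<Longrightarrow> length q \<le> 2" for B
    proof -
      have "u' = u \<and> v' = v" if "u' \<in> B" "v' \<in> B" "rev u' @ v' = rev u @ v" for u' v'
      proof -
        have "length u' + length v' = 4" using arg_cong[OF that(3), of length] len \<open>u \<in> C\<close> \<open>v \<in> C\<close> by simp
        then have "length u' = length u" using B(2)[OF that(1)] B(2)[OF that(2)] len[OF \<open>u \<in> C\<close>] by simp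
        then show ?thesis using that(3) by simp
      qed
      then show ?thesis using B(1) \<open>u \<in> C\<close> \<open>v \<in> C\<close> by auto
    qed
    have "?c (rev u @ v) = Gx u v"
    proof -
      have "count_in (range VarX) (rev u @ v) = 2" using count_C that by simp
      moreover have "{(u', v'). u' \<in> x.borders \<and> v' \<in> x.borders \<and> rev u' @ v' = rev u @ v} = {(u, v)}"
        by (rule single) (use len in \<open>auto simp: bx P_def\<close>)
      ultimately show ?thesis using Gx(2)[of "rev u @ v"] by simp
    qed
    moreover have "?c (rev u @ v) = Ga u v"
    proof -
      have "count_in (range VarA) (rev u @ v) = 2" using count_C that by simp
      moreover have "{(u', v'). u' \<in> a.borders \<and> v' \<in> a.borders \<and> rev u' @ v' = rev u @ v} = {(u, v)}"
        by (rule single) (use len in \<open>auto simp: ba Q_def\<close>)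
      ultimately show ?thesis using Ga(2)[of "rev u @ v"] by simp
    qed
    ultimately show ?thesis by simp
  qed
  define G where "G u v = (if u \<in> C \<union> P \<and> v \<in> C \<union> P then Gx u v else Ga u v)" for u v
  have G_x: "G u v = Gx u v" if "u \<in> C \<union> P" "v \<in> C \<union> P" for u v using that by (simp add: G_def)
  have G_a: "G u v = Ga u v" if "u \<in> C \<union> Q" "v \<in> C \<union> Q" for u v
    using that disj common by (auto simp: G_def)
  have "psd_on (C \<union> P) G" using Gx(1) unfolding bx psd_on_def by (simp add: G_x)
  moreover have "psd_on (C \<union> Q) G" using Ga(1) unfolding ba psd_on_def by (simp add: G_a)
  ultimately obtain H where H: "psd_on (C \<union> P \<union> Q) H"
    "\<And>u v. u \<in> C \<union> P \<Longrightarrow> v \<in> C \<union> P \<Longrightarrow> H u v = Gx u v"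
    "\<And>u v. u \<in> C \<union> Q \<Longrightarrow> v \<in> C \<union> Q \<Longrightarrow> H u v = Ga u v"
    using psd_completion[OF fin disj] G_x G_a by metis
  define B where "B = C \<union> P \<union> Q"
  have finB: "finite B" using fin by (simp add: B_def)
  obtain l where l: "\<And>u v. u \<in> B \<Longrightarrow> v \<in> B \<Longrightarrow> H u v = (\<Sum>k\<in>B. l k u * l k v)"
    using psd_on_factor[OF finB, of H] H(1) unfolding B_def by blast
  obtain e where e: "bij_betw e {1..card B} B"
    using ex_bij_betw_nat_finite_1[OF finB] by blast
  \<comment> \<open>Enumerating the factors by \<open>{1..card B}\<close> gives the index range of the statement.\<close>
  define \<Lambda> where "\<Lambda> j = combination B (l (e j))" for j
  define L where "L = p - (\<Sum>j=1..card B. involution (\<Lambda> j) * \<Lambda> j)"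
  have count_B: "count_in (range VarX) u \<le> 1 \<and> count_in (range VarA) u \<le> 1" if "u \<in> B" for u
    using that by (auto simp: B_def C_def P_def Q_def)
  have \<Lambda>: "degree_x (\<Lambda> j) \<le> 1 \<and> degree_a (\<Lambda> j) \<le> 1" for j
    unfolding degree_x_def degree_a_def degree_in_le_iff \<Lambda>_def coeffs_of_combination[OF finB]
    using count_B by auto
  have coeffs_L: "coeffs_of L w = ?c w - (\<Sum>(u, v) | u \<in> B \<and> v \<in> B \<and> rev u @ v = w. H u v)" for w
  proof -
    let ?pairs = "{(u, v). u \<in> B \<and> v \<in> B \<and> rev u @ v = w}"
    have "coeffs_of (\<Sum>j=1..card B. involution (\<Lambda> j) * \<Lambda> j) w
        = (\<Sum>j=1..card B. coeffs_of (involution (\<Lambda> j) * \<Lambda> j) w)"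
      by (simp add: coeffs_of_def lookup_sum)
    also have "\<dots> = (\<Sum>j=1..card B. \<Sum>(u, v)\<in>?pairs. l (e j) u * l (e j) v)"
      by (simp add: \<Lambda>_def coeffs_of_combination_square[OF finB])
    also have "\<dots> = (\<Sum>k\<in>B. \<Sum>(u, v)\<in>?pairs. l k u * l k v)"
      by (rule sum.reindex_bij_betw[OF e])
    also have "\<dots> = (\<Sum>(u, v)\<in>?pairs. H u v)"
      by (subst sum.swap) (auto simp: l intro!: sum.cong)
    finally show ?thesis by (simp add: L_def coeffs_of_def lookup_minus)
  qed
  have "degree_x L \<le> 1"
    unfolding degree_x_def degree_in_le_iff
  proof (intro allI impI)
    fix w assume "coeffs_of L w \<noteq> 0"
    then show "count_in (range VarX) w \<le> 1"
      by (intro x.residual_degree[OF _ _ Gx(2), where B = B and H = H])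
        (auto simp: coeffs_L bx H(2), auto simp: B_def Q_def)
  qed
  moreover have "degree_a L \<le> 1"
    unfolding degree_a_def degree_in_le_iff
  proof (intro allI impI)
    fix w assume "coeffs_of L w \<noteq> 0"
    then show "count_in (range VarA) w \<le> 1"
      by (intro a.residual_degree[OF _ _ Ga(2), where B = B and H = H])
        (auto simp: coeffs_L ba H(3), auto simp: B_def P_def)
  qed
  moreover have "p = L + (\<Sum>j=1..card B. involution (\<Lambda> j) * \<Lambda> j)" by (simp add: L_def)
  ultimately show ?thesis using \<Lambda> by blast
qed

end
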